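(* For every $\alpha > 1$ there exist constants $c_1(\alpha), c_2(\alpha) > 0$ depending only on $\alpha$ such that for every $n \ge 1$ and all $p_1,\dots,p_n \in [0,1]$ with $\lambda = p_1+\dots+p_n > 0$, setting $\lambda_2 = p_1^2+\dots+p_n^2$ and $$F = \frac{\max(1,\lambda)}{\max(1,\lambda-\lambda_2)},$$ one has $$c_1(\alpha) \Big(\frac{\lambda_2}{\lambda}\Big)^2 F^{\frac{\alpha-1}{2}} \le T_\alpha(W||Z) \le c_2(\alpha) \Big(\frac{\lambda_2}{\lambda}\Big)^2 F^{\frac{\alpha-1}{2}}.$$ In particular, for every $\alpha>1$ there is a constant $c_\alpha>0$ depending only on $\alpha$ such that $T_\alpha(W||Z) \le c_\alpha\, \chi^2(W,Z)$ whenever $\frac{\lambda_2}{\lambda} \le \frac12$.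
   Context: $W = X_1+\dots+X_n$ is the sum of independent random variables $X_j$ taking the values $1$ and $0$ with probabilities $p_j$ and $q_j = 1-p_j$. $Z$ is a Poisson random variable with parameter $\lambda = p_1+\dots+p_n$. Write $w_k = \mathbb{P}\{W=k\}$ and $v_k = \mathbb{P}\{Z=k\} = \frac{\lambda^k}{k!}e^{-\lambda}$, $k = 0,1,2,\dots$. The relative Tsallis entropy of order $\alpha>1$ and the Pearson $\chi^2$-distance are $$T_\alpha(W||Z) = \frac{1}{\alpha-1}\bigg[\sum_{k=0}^\infty \Big(\frac{w_k}{v_k}\Big)^\alpha v_k - 1\bigg], \qquad \chi^2(W,Z) = \sum_{k=0}^\infty \frac{(w_k-v_k)^2}{v_k}.$$ *)

theory Defs
  imports "HOL-Probability.Probability"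
begin

(* Law of W = X_1 + ... + X_n, realised on the product space of the Bernoulli laws.  Working with
   the law keeps the sample space out of the statement: a type variable for it would be fixed
   outside the existential quantifiers, so the constants could depend on it.  Lemma
   prob_sum_eq_pmf_bernoulli_sum covers arbitrary probability spaces. *)
definition bernoulli_sum_pmf :: "nat \<Rightarrow> (nat \<Rightarrow> real) \<Rightarrow> nat pmf" where
  "bernoulli_sum_pmf n p =
     map_pmf (\<lambda>x. \<Sum>j=1..n. of_bool (x j)) (Pi_pmf {1..n} False (\<lambda>j. bernoulli_pmf (p j)))"

(* In both definitions below, P is meant to be a law such that the series converges,
   see bernoulli_sum_poisson_summable, and Q to have full support. *)
definition tsallis_entropy :: "real \<Rightarrow> nat pmf \<Rightarrow> nat pmf \<Rightarrow> real" where
  "tsallis_entropy \<alpha> P Q =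
     1 / (\<alpha> - 1) * ((\<Sum>k. (pmf P k / pmf Q k) powr \<alpha> * pmf Q k) - 1)"

definition chi2_distance :: "nat pmf \<Rightarrow> nat pmf \<Rightarrow> real" where
  "chi2_distance P Q = (\<Sum>k. (pmf P k - pmf Q k)\<^sup>2 / pmf Q k)"

lemma prob_sum_eq_pmf_bernoulli_sum:
  fixes M :: "'a measure" and X :: "nat \<Rightarrow> 'a \<Rightarrow> real" and p :: "nat \<Rightarrow> real"
  assumes M: "prob_space M"
    and indep: "prob_space.indep_vars M (\<lambda>_. borel) X {1..n}"
    and p1: "\<And>j. j \<in> {1..n} \<Longrightarrow> measure M {\<omega> \<in> space M. X j \<omega> = 1} = p j"
    and p0: "\<And>j. j \<in> {1..n} \<Longrightarrow> measure M {\<omega> \<in> space M. X j \<omega> = 0} = 1 - p j"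
  shows "measure M {\<omega> \<in> space M. (\<Sum>j=1..n. X j \<omega>) = real k} = pmf (bernoulli_sum_pmf n p) k"
proof -
  interpret prob_space M by (rule M)
  define I where "I = {1..n}"
  have rv[measurable]: "X j \<in> borel_measurable M" if "j \<in> I" for j
    using indep that unfolding indep_vars_def I_def by auto
  define r where "r b = (of_bool b :: real)" for b
  define B where "B = {b \<in> PiE_dflt I False (\<lambda>_. UNIV). (\<Sum>j\<in>I. of_bool (b j)) = k}"
  define E where "E b = {\<omega> \<in> space M. \<forall>j\<in>I. X j \<omega> = r (b j)}" for b
  have finI: "finite I" by (simp add: I_def)
  have finB: "finite B" unfolding B_def
    by (rule finite_subset[OF _ finite_PiE_dflt[OF finI, of "\<lambda>_. UNIV" False]]) auto
  have p01: "0 \<le> p j" "p j \<le> 1" if "j \<in> I" for j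
    using p1[of j] p0[of j] that measure_nonneg[of M "{\<omega> \<in> space M. X j \<omega> = 1}"]
      measure_nonneg[of M "{\<omega> \<in> space M. X j \<omega> = 0}"] unfolding I_def by linarith+
  have E_sets: "E b \<in> sets M" for b
    unfolding E_def
  proof (rule sets.sets_Collect_finite_All[OF _ finI])
    fix j assume "j \<in> I"
    then show "{\<omega> \<in> space M. X j \<omega> = r (b j)} \<in> sets M"
      by measurable
  qed
  have probE: "prob (E b) = (\<Prod>j\<in>I. pmf (bernoulli_pmf (p j)) (b j))" for b
  proof (cases "I = {}")
    case True
    then show ?thesis by (simp add: E_def prob_space)
  next
    case False
    have "E b = (\<Inter>j\<in>I. X j -` {r (b j)} \<inter> space M)"
      using False by (auto simp: E_def)
    also have "prob \<dots> = (\<Prod>j\<in>I. prob (X j -` {r (b j)} \<inter> space M))"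
      using False finI indep unfolding I_def
      by (intro indep_varsD[where I = "{1..n}" and M' = "\<lambda>_. borel"]) auto
    also have "\<dots> = (\<Prod>j\<in>I. pmf (bernoulli_pmf (p j)) (b j))"
    proof (rule prod.cong[OF refl])
      fix j assume j: "j \<in> I"
      have "X j -` {r (b j)} \<inter> space M = {\<omega> \<in> space M. X j \<omega> = r (b j)}" by auto
      then show "prob (X j -` {r (b j)} \<inter> space M) = pmf (bernoulli_pmf (p j)) (b j)"
        using p1[of j] p0[of j] p01[OF j] j by (cases "b j") (auto simp: r_def I_def)
    qed
    finally show ?thesis .
  qed
  have AE01: "AE \<omega> in M. \<forall>j\<in>I. X j \<omega> = 0 \<or> X j \<omega> = 1"
  proof (rule AE_finite_allI[OF finI])
    fix j assume j: "j \<in> I"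
    have "{\<omega> \<in> space M. X j \<omega> = 0 \<or> X j \<omega> = 1}
        = {\<omega> \<in> space M. X j \<omega> = 0} \<union> {\<omega> \<in> space M. X j \<omega> = 1}" by auto
    also have "prob \<dots> = prob {\<omega> \<in> space M. X j \<omega> = 0} + prob {\<omega> \<in> space M. X j \<omega> = 1}"
      using j by (intro finite_measure_Union) auto
    also have "\<dots> = 1" using p1[of j] p0[of j] j by (simp add: I_def)
    finally have "AE \<omega> in M. \<omega> \<in> {\<omega> \<in> space M. X j \<omega> = 0 \<or> X j \<omega> = 1}"
      by (rule AE_prob_1)
    then show "AE \<omega> in M. X j \<omega> = 0 \<or> X j \<omega> = 1"
      by eventually_elim simp
  qed
  have "measure M {\<omega> \<in> space M. (\<Sum>j=1..n. X j \<omega>) = real k} = prob (\<Union>b\<in>B. E b)"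
  proof (rule measure_eq_AE)
    show "AE \<omega> in M. \<omega> \<in> {\<omega> \<in> space M. (\<Sum>j=1..n. X j \<omega>) = real k} \<longleftrightarrow> \<omega> \<in> (\<Union>b\<in>B. E b)"
      using AE01 AE_space
    proof eventually_elim
      case (elim \<omega>)
      define b where "b j = (j \<in> I \<and> X j \<omega> = 1)" for j
      have Xb: "X j \<omega> = r (b j)" if "j \<in> I" for j
        using elim that by (auto simp: b_def r_def)
      have sum_b: "(\<Sum>j\<in>I. X j \<omega>) = real (\<Sum>j\<in>I. of_bool (c j))"
        if "\<forall>j\<in>I. X j \<omega> = r (c j)" for c
        using that by (simp add: r_def)
      show ?case
      proof
        assume "\<omega> \<in> {\<omega> \<in> space M. (\<Sum>j=1..n. X j \<omega>) = real k}"
        then have "real (\<Sum>j\<in>I. of_bool (b j)) = real k"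
          by (subst sum_b[symmetric]) (use Xb in \<open>auto simp: I_def\<close>)
        then have "(\<Sum>j\<in>I. of_bool (b j)) = k"
          by (rule of_nat_eq_iff[THEN iffD1])
        then have "b \<in> B" by (auto simp: B_def PiE_dflt_def b_def)
        moreover have "\<omega> \<in> E b" using elim Xb by (auto simp: E_def)
        ultimately show "\<omega> \<in> (\<Union>b\<in>B. E b)" by blast
      next
        assume "\<omega> \<in> (\<Union>b\<in>B. E b)"
        then obtain c where "c \<in> B" "\<omega> \<in> E c" by blast
        then have "(\<Sum>j\<in>I. X j \<omega>) = real k"
          by (subst sum_b[of c]) (auto simp: E_def B_def)
        then show "\<omega> \<in> {\<omega> \<in> space M. (\<Sum>j=1..n. X j \<omega>) = real k}"
          using elim by (simp add: I_def)
      qed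
    qed
    have "(\<lambda>\<omega>. \<Sum>j\<in>I. X j \<omega>) \<in> borel_measurable M"
      by (intro borel_measurable_sum rv)
    then show "{\<omega> \<in> space M. (\<Sum>j=1..n. X j \<omega>) = real k} \<in> sets M"
      unfolding I_def by measurable
    show "(\<Union>b\<in>B. E b) \<in> sets M" using finB E_sets by auto
  qed
  also have "\<dots> = (\<Sum>b\<in>B. prob (E b))"
  proof (rule finite_measure_finite_Union[OF finB])
    show "disjoint_family_on E B"
    proof (unfold disjoint_family_on_def, intro ballI impI)
      fix b c assume bc: "b \<in> B" "c \<in> B" "b \<noteq> c"
      then obtain j where "b j \<noteq> c j" by auto
      moreover from this have "j \<in> I" using bc by (auto simp: B_def PiE_dflt_def)
      ultimately show "E b \<inter> E c = {}" by (force simp: E_def r_def)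
    qed
  qed (use E_sets in auto)
  also have "\<dots> = (\<Sum>b\<in>B. pmf (Pi_pmf I False (\<lambda>j. bernoulli_pmf (p j))) b)"
    using finI by (intro sum.cong refl) (auto simp: probE pmf_Pi B_def PiE_dflt_def)
  also have "\<dots> = measure (Pi_pmf I False (\<lambda>j. bernoulli_pmf (p j))) B"
    using finB by (simp add: measure_measure_pmf_finite)
  also have "\<dots> = measure (Pi_pmf I False (\<lambda>j. bernoulli_pmf (p j)))
                    ((\<lambda>x. \<Sum>j\<in>I. of_bool (x j)) -` {k})"
  proof (rule measure_eq_AE)
    show "AE x in Pi_pmf I False (\<lambda>j. bernoulli_pmf (p j)).
            x \<in> B \<longleftrightarrow> x \<in> (\<lambda>x. \<Sum>j\<in>I. of_bool (x j)) -` {k}"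
      using set_Pi_pmf_subset'[OF finI, of False "\<lambda>j. bernoulli_pmf (p j)"]
      by (auto simp: AE_measure_pmf_iff B_def PiE_dflt_def)
  qed auto
  also have "\<dots> = pmf (bernoulli_sum_pmf n p) k"
    by (simp add: bernoulli_sum_pmf_def I_def pmf_map)
  finally show ?thesis .
qed

lemma bernoulli_sum_poisson_summable:
  assumes "(\<Sum>j=1..n. p j) > 0"
  defines "P \<equiv> bernoulli_sum_pmf n p" and "Q \<equiv> poisson_pmf (\<Sum>j=1..n. p j)"
  shows "summable (\<lambda>k. (pmf P k / pmf Q k) powr \<alpha> * pmf Q k)"
    and "summable (\<lambda>k. (pmf P k - pmf Q k)\<^sup>2 / pmf Q k)"
proof -
  have P0: "pmf P k = 0" if "k > n" for k
  proof -
    have "(\<Sum>j=1..n. of_bool (x j)) \<le> n" for x :: "nat \<Rightarrow> bool"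
      using sum_bounded_above[of "{1..n}" "\<lambda>j. of_bool (x j) :: nat" 1] by simp
    then have "m \<le> n" if "m \<in> set_pmf P" for m
      using that unfolding P_def bernoulli_sum_pmf_def set_map_pmf by (elim imageE) (simp only:)
    then have "k \<notin> set_pmf P"
      using that by (meson not_le)
    then show ?thesis by (simp add: set_pmf_iff)
  qed
  have Q: "summable (pmf Q)"
    using pmf_abs_summable[of Q UNIV]
    by (simp add: abs_summable_on_nat_iff')
  show "summable (\<lambda>k. (pmf P k / pmf Q k) powr \<alpha> * pmf Q k)"
    by (rule summable_finite[of "{..n}"]) (auto simp: P0)
  have "eventually (\<lambda>k. (pmf P k - pmf Q k)\<^sup>2 / pmf Q k = pmf Q k) sequentially"
    using eventually_gt_at_top[of n]
    by eventually_elim (simp add: P0 power2_eq_square)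
  then show "summable (\<lambda>k. (pmf P k - pmf Q k)\<^sup>2 / pmf Q k)"
    using Q summable_cong[of "\<lambda>k. (pmf P k - pmf Q k)\<^sup>2 / pmf Q k" "pmf Q"] by simp
qed

end

theory Submission
  imports Defs "HOL-Complex_Analysis.Cauchy_Integral_Formula"
begin

text \<open>
  Write \<open>f = w / v\<close> for the likelihood ratio, \<open>\<kappa> = \<lambda>\<^sub>2 / \<lambda>\<close>, and note that \<open>(\<alpha> - 1) T\<close> is the
  Poisson mean of \<open>\<phi>(f)\<close> with \<open>\<phi>(x) = x\<^sup>\<alpha> - 1 - \<alpha> (x - 1)\<close>. Three facts give the theorem.

  \<^item> \<open>f \<le> C \<surd>F\<close> everywhere: integrate the generating function of \<open>W\<close> over the circle of radius
    \<open>r = k / \<lambda>\<close> and compare with Stirling's formula. The loss in the integral is governed by the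
    variance of the tilted sum; if that is too small because many \<open>p\<^sub>j (r - 1)\<close> exceed \<open>1\<close>, the
    product of the factors \<open>(1 + p\<^sub>j (r - 1)) exp (- p\<^sub>j (r - 1))\<close> compensates.
  \<^item> \<open>\<chi>\<^sup>2\<close> is of order \<open>\<kappa>\<^sup>2\<close> for \<open>\<kappa> \<le> 1/2\<close> and at least \<open>\<kappa>\<^sup>2 / 2\<close> always: by Parseval for the
    Charlier polynomials it is a weighted sum of the squared Taylor coefficients of
    \<open>\<Prod> (1 + p\<^sub>j z) exp (- p\<^sub>j z)\<close>, which Cauchy's inequality bounds since
    \<open>\<bar>(1 + z) exp (- z)\<bar> \<le> exp (\<bar>z\<bar>\<^sup>2 / 2)\<close>. As \<open>\<phi>(x)\<close> is comparable to \<open>(x - 1)\<^sup>2\<close> on bounded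
    intervals, \<open>T\<close> is comparable to \<open>\<chi>\<^sup>2\<close> as long as \<open>F\<close> is bounded.
  \<^item> If \<open>F\<close> is large, \<open>W\<close> lies with probability \<open>3/4\<close> in an interval of Poisson probability
    \<open>O(1 / \<surd>F)\<close>, which forces \<open>T\<close> to be of order \<open>F\<close> to the power \<open>(\<alpha> - 1) / 2\<close>; the matching
    upper bound is immediate from \<open>f \<le> C \<surd>F\<close>.
\<close>

section \<open>Sums of independent Bernoulli variables\<close>

lemma bernoulli_sum_pmf_0: "bernoulli_sum_pmf 0 p = return_pmf 0"
  by (simp add: bernoulli_sum_pmf_def)

lemma bernoulli_sum_pmf_Suc:
  "bernoulli_sum_pmf (Suc n) p =
     bind_pmf (bernoulli_pmf (p (Suc n))) (\<lambda>b. map_pmf (\<lambda>k. k + of_bool b) (bernoulli_sum_pmf n p))"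
proof -
  have "Pi_pmf {1..Suc n} False (\<lambda>j. bernoulli_pmf (p j)) =
      do {y \<leftarrow> bernoulli_pmf (p (Suc n)); f \<leftarrow> Pi_pmf {1..n} False (\<lambda>j. bernoulli_pmf (p j));
          return_pmf (f(Suc n := y))}"
    by (simp add: atLeastAtMostSuc_conv Pi_pmf_insert')
  then show ?thesis
    by (auto simp: bernoulli_sum_pmf_def map_bind_pmf map_pmf_def bind_return_pmf bind_assoc_pmf
        intro!: bind_pmf_cong arg_cong[where f = return_pmf] arg_cong[where f = card])
qed

lemma pmf_bernoulli_sum_Suc:
  assumes "p (Suc n) \<in> {0..1}"
  shows "pmf (bernoulli_sum_pmf (Suc n) p) k =
    (1 - p (Suc n)) * pmf (bernoulli_sum_pmf n p) k +
    p (Suc n) * (if k = 0 then 0 else pmf (bernoulli_sum_pmf n p) (k - 1))"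
proof -
  have *: "pmf (map_pmf Suc P) k = (if k = 0 then 0 else pmf P (k - 1))" for P
  proof (cases k)
    case 0
    have "Suc -` {0} = {}" by auto
    with 0 show ?thesis by (simp add: pmf_map)
  next
    case (Suc m)
    with pmf_map_inj'[of Suc P m] show ?thesis by simp
  qed
  from assms show ?thesis
    unfolding bernoulli_sum_pmf_Suc pmf_bind
    by (subst integral_bernoulli_pmf) (auto simp: * map_pmf_ident algebra_simps)
qed

lemma pmf_bernoulli_sum_eq_0:
  assumes "\<forall>j\<in>{1..n}. p j \<in> {0..1}" "n < k"
  shows "pmf (bernoulli_sum_pmf n p) k = 0"
  using assms
proof (induction n arbitrary: k)
  case 0
  then show ?case by (simp add: bernoulli_sum_pmf_0)
next
  case (Suc n)
  then show ?case by (subst pmf_bernoulli_sum_Suc) auto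
qed

text \<open>Conditioning on the last variable, tested against an arbitrary \<open>g\<close>. Taking
  powers of \<open>z\<close>, the identity and the square for \<open>g\<close> makes the generating
  function and both moments simple inductions; vector values cover complex \<open>z\<close>.\<close>

lemma sum_pmf_bernoulli_sum_Suc:
  fixes g :: "nat \<Rightarrow> 'a::real_vector"
  assumes "\<forall>j\<in>{1..Suc n}. p j \<in> {0..1}"
  shows "(\<Sum>k\<le>Suc n. pmf (bernoulli_sum_pmf (Suc n) p) k *\<^sub>R g k) =
    (1 - p (Suc n)) *\<^sub>R (\<Sum>k\<le>n. pmf (bernoulli_sum_pmf n p) k *\<^sub>R g k) +
    p (Suc n) *\<^sub>R (\<Sum>k\<le>n. pmf (bernoulli_sum_pmf n p) k *\<^sub>R g (Suc k))"
proof -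
  let ?w = "pmf (bernoulli_sum_pmf n p)"
  have "(\<Sum>k\<le>Suc n. pmf (bernoulli_sum_pmf (Suc n) p) k *\<^sub>R g k) =
    (\<Sum>k\<le>Suc n. (1 - p (Suc n)) *\<^sub>R (?w k *\<^sub>R g k)) +
    (\<Sum>k\<le>Suc n. p (Suc n) *\<^sub>R ((if k = 0 then 0 else ?w (k - 1)) *\<^sub>R g k))"
    by (subst sum.distrib[symmetric], intro sum.cong refl, subst pmf_bernoulli_sum_Suc)
      (use assms in \<open>auto simp: scaleR_add_left\<close>)
  also have "(\<Sum>k\<le>Suc n. (1 - p (Suc n)) *\<^sub>R (?w k *\<^sub>R g k)) =
      (1 - p (Suc n)) *\<^sub>R (\<Sum>k\<le>n. ?w k *\<^sub>R g k)"
    using pmf_bernoulli_sum_eq_0[of n p "Suc n"] assms by (simp add: scaleR_sum_right)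
  also have "(\<Sum>k\<le>Suc n. p (Suc n) *\<^sub>R ((if k = 0 then 0 else ?w (k - 1)) *\<^sub>R g k)) =
      p (Suc n) *\<^sub>R (\<Sum>k\<le>n. ?w k *\<^sub>R g (Suc k))"
    by (subst sum.atMost_Suc_shift) (simp add: scaleR_sum_right)
  finally show ?thesis .
qed

lemma bernoulli_sum_gf:
  fixes z :: "'a::{real_algebra_1, comm_ring_1}"
  assumes "\<forall>j\<in>{1..n}. p j \<in> {0..1}"
  shows "(\<Sum>k\<le>n. pmf (bernoulli_sum_pmf n p) k *\<^sub>R z ^ k) =
    (\<Prod>j=1..n. of_real (1 - p j) + of_real (p j) * z)"
  using assms
proof (induction n)
  case 0
  then show ?case by (simp add: bernoulli_sum_pmf_0)
next
  case (Suc n)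
  let ?S = "\<Sum>k\<le>n. pmf (bernoulli_sum_pmf n p) k *\<^sub>R z ^ k"
  have "(\<Sum>k\<le>n. pmf (bernoulli_sum_pmf n p) k *\<^sub>R z ^ Suc k) = z * ?S"
    by (simp add: sum_distrib_left)
  with Suc show ?case
    by (subst sum_pmf_bernoulli_sum_Suc) (auto simp: algebra_simps scaleR_conv_of_real)
qed

lemma bernoulli_sum_total:
  assumes "\<forall>j\<in>{1..n}. p j \<in> {0..1}"
  shows "(\<Sum>k\<le>n. pmf (bernoulli_sum_pmf n p) k) = 1"
  using bernoulli_sum_gf[where z = "1::real" and n = n and p = p] assms by simp

lemma bernoulli_sum_mean:
  assumes "\<forall>j\<in>{1..n}. p j \<in> {0..1}"
  shows "(\<Sum>k\<le>n. pmf (bernoulli_sum_pmf n p) k * real k) = (\<Sum>j=1..n. p j)"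
  using assms
proof (induction n)
  case (Suc n)
  note eq = sum_pmf_bernoulli_sum_Suc[of n p real, OF Suc.prems, unfolded real_scaleR_def]
  show ?case
    unfolding eq using Suc bernoulli_sum_total[of n p]
    by (simp add: ring_distribs sum.distrib)
qed simp

lemma bernoulli_sum_second_moment:
  assumes "\<forall>j\<in>{1..n}. p j \<in> {0..1}"
  shows "(\<Sum>k\<le>n. pmf (bernoulli_sum_pmf n p) k * (real k)\<^sup>2) =
    (\<Sum>j=1..n. p j)\<^sup>2 + (\<Sum>j=1..n. p j) - (\<Sum>j=1..n. (p j)\<^sup>2)"
  using assms
proof (induction n)
  case (Suc n)
  note eq = sum_pmf_bernoulli_sum_Suc[of n p "\<lambda>k. (real k)\<^sup>2", OF Suc.prems, unfolded real_scaleR_def]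
  let ?w = "pmf (bernoulli_sum_pmf n p)"
  have "(\<Sum>k\<le>n. ?w k * (real (Suc k))\<^sup>2) =
      (\<Sum>k\<le>n. ?w k * (real k)\<^sup>2) + 2 * (\<Sum>k\<le>n. ?w k * real k) + (\<Sum>k\<le>n. ?w k)"
    by (simp add: sum.distrib[symmetric] sum_distrib_left power2_eq_square algebra_simps)
  then show ?case
    unfolding eq using Suc bernoulli_sum_total[of n p] bernoulli_sum_mean[of n p]
    by (simp add: power2_eq_square algebra_simps)
qed simp

lemma bernoulli_sum_variance:
  assumes "\<forall>j\<in>{1..n}. p j \<in> {0..1}"
  shows "(\<Sum>k\<le>n. pmf (bernoulli_sum_pmf n p) k * (real k - (\<Sum>j=1..n. p j))\<^sup>2) =
    (\<Sum>j=1..n. p j) - (\<Sum>j=1..n. (p j)\<^sup>2)"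
proof -
  let ?w = "pmf (bernoulli_sum_pmf n p)" and ?l = "\<Sum>j=1..n. p j"
  have "(\<Sum>k\<le>n. ?w k * (real k - l)\<^sup>2) =
    (\<Sum>k\<le>n. ?w k * (real k)\<^sup>2) - 2 * l * (\<Sum>k\<le>n. ?w k * real k) + l\<^sup>2 * (\<Sum>k\<le>n. ?w k)" for l
    by (simp add: sum.distrib[symmetric] sum_subtractf[symmetric] sum_distrib_left
        power2_eq_square algebra_simps)
  then show ?thesis
    unfolding bernoulli_sum_total[OF assms] bernoulli_sum_mean[OF assms]
      bernoulli_sum_second_moment[OF assms]
    by (simp add: power2_eq_square)
qed

section \<open>Elementary inequalities\<close>

lemma fact_le_stirling:
  assumes "k \<ge> 1"
  shows "fact k \<le> exp 1 * sqrt (real k) * real k ^ k * exp (- real k)"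
  using assms
proof (induction k rule: dec_induct)
  case (step k)
  \<comment> \<open>The induction step amounts to (k + 1/2) ln (1 + 1/k) \<ge> 1, with equality of
    the two sides of the lemma at k = 1. With this \<open>x\<close>, 1 + 1/k is (1 + x) / (1 - x),
    whose logarithm has an odd expansion starting with 2x.\<close>
  define x where "x = 1 / (2 * real k + 1)"
  have k: "real k \<ge> 1" using step by simp
  have x: "0 < x" "x < 1" using k by (auto simp: x_def)
  have ratio: "(1 + x) / (1 - x) = 1 + 1 / real k"
  proof -
    have "1 + x = 2 * (real k + 1) / (2 * real k + 1)" "1 - x = 2 * real k / (2 * real k + 1)"
      using k by (auto simp: x_def field_simps)
    then have "(1 + x) / (1 - x) =
        (2 * (real k + 1) / (2 * real k + 1)) / (2 * real k / (2 * real k + 1))"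
      by (simp only:)
    also have "\<dots> = 1 + 1 / real k"
    proof -
      have "a / c / (b / c) = a / b" if "c \<noteq> 0" for a b c :: real
        using that by simp
      from this[of "2 * real k + 1" "2 * (real k + 1)" "2 * real k"] show ?thesis
        using k by (simp add: add_divide_distrib)
    qed
    finally show ?thesis .
  qed
  have "2 * x \<le> ln ((1 + x) / (1 - x))"
  proof -
    define g where "g = (\<lambda>y::real. ln (1 + y) - ln (1 - y) - 2 * y)"
    have "g 0 \<le> g x"
    proof (rule DERIV_nonneg_imp_nondecreasing[where f = g])
      fix y assume y: "0 \<le> y" "y \<le> x"
      have "(g has_real_derivative (1 / (1 + y) + 1 / (1 - y) - 2)) (at y)"
        unfolding g_def using y x by (auto intro!: derivative_eq_intros)
      moreover have "1 / (1 + y) + 1 / (1 - y) - 2 = 2 * y\<^sup>2 / ((1 + y) * (1 - y))"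
      proof -
        have "1 + y \<noteq> 0" "1 - y \<noteq> 0" using y x by auto
        then show ?thesis
          by (simp add: divide_simps) (simp add: algebra_simps power2_eq_square)
      qed
      moreover have "\<dots> \<ge> 0" using y x by (intro divide_nonneg_nonneg) auto
      ultimately show "\<exists>d. (g has_real_derivative d) (at y) \<and> 0 \<le> d" by metis
    qed (use x in auto)
    then show ?thesis using x by (simp add: g_def ln_div)
  qed
  then have "1 \<le> (real k + 1 / 2) * ln (1 + 1 / real k)"
    unfolding ratio using k by (simp add: x_def field_simps)
  then have "exp 1 \<le> exp ((real k + 1 / 2) * ln (1 + 1 / real k))"
    by simp
  also have "\<dots> = (1 + 1 / real k) ^ k * sqrt (1 + 1 / real k)"
  proof -
    have pos: "1 + 1 / real k > 0" using k by (simp add: add_pos_nonneg)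
    then have "exp (real k * ln (1 + 1 / real k)) = (1 + 1 / real k) ^ k"
      by (simp add: exp_of_nat_mult)
    moreover have "exp (1 / 2 * ln (1 + 1 / real k)) = sqrt (1 + 1 / real k)"
      using pos by (simp add: powr_half_sqrt[symmetric] powr_def)
    ultimately show ?thesis by (simp add: distrib_right exp_add)
  qed
  finally have e: "exp 1 \<le> (1 + 1 / real k) ^ k * sqrt (1 + 1 / real k)" .
  have s: "sqrt (real (Suc k)) = sqrt (real k) * sqrt (1 + 1 / real k)"
    using k by (simp add: real_sqrt_mult[symmetric] field_simps)
  have q: "real (Suc k) ^ k = real k ^ k * (1 + 1 / real k) ^ k"
    using k by (simp add: power_mult_distrib[symmetric] field_simps)
  have "fact (Suc k) \<le> real (Suc k) * (exp 1 * sqrt (real k) * real k ^ k * exp (- real k))"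
    using step.IH by (simp add: mult_left_mono del: of_nat_Suc)
  also have "\<dots> = (real (Suc k) * sqrt (real k) * real k ^ k * exp (- real k)) * exp 1"
    by simp
  also have "\<dots> \<le> (real (Suc k) * sqrt (real k) * real k ^ k * exp (- real k)) *
      ((1 + 1 / real k) ^ k * sqrt (1 + 1 / real k))"
    using e by (intro mult_left_mono) auto
  also have "\<dots> = exp 1 * sqrt (real (Suc k)) * real (Suc k) ^ Suc k * exp (- real (Suc k))"
  proof -
    have "exp (- real (Suc k)) * exp 1 = exp (- real k)"
      by (simp add: exp_add[symmetric])
    then show ?thesis
      unfolding s power_Suc q by (simp add: mult_ac)
  qed
  finally show ?case .
qed (simp add: exp_minus)

text \<open>For parameter k, each of about sqrt k values from k upwards has at least 1/e times the
  probability of k, and together they have at most 1. Parameter k is also the one that maximises the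
  probability of k.\<close>

lemma poisson_pmf_le:
  assumes "l > 0" "k \<ge> 1"
  shows "pmf (poisson_pmf l) k \<le> exp 1 / sqrt (real k)"
proof -
  let ?v = "pmf (poisson_pmf (real k))"
  have k: "real k > 0" using assms by simp
  \<comment> \<open>For i \<le> N the loss exp (i * i / k) is at most e, while the N + 1 values
    still number at least sqrt k.\<close>
  define N where "N = nat \<lfloor>sqrt (real k)\<rfloor>"
  have N: "real N \<le> sqrt (real k)" "sqrt (real k) \<le> real N + 1"
    unfolding N_def by (auto simp: of_nat_floor intro: less_imp_le)
  have ratio: "?v k / exp 1 \<le> ?v (k + i)" if "i \<le> N" for i
  proof -
    have "fact (k + i) \<le> fact k * (real k + real i) ^ i" for i
    proof (induction i)
      case (Suc i)
      have "fact (k + Suc i) = (real k + real (Suc i)) * fact (k + i)"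
        by simp
      also have "\<dots> \<le> (real k + real (Suc i)) * (fact k * (real k + real (Suc i)) ^ i)"
        by (intro mult_left_mono order_trans[OF Suc] power_mono) auto
      finally show ?case by (simp add: mult_ac)
    qed simp
    note f = this[of i]
    have i: "real i \<le> sqrt (real k)" using that N by linarith
    then have "real i * real i \<le> real k"
      using mult_mono[OF i i] by simp
    have "(real k + real i) ^ i = real k ^ i * (1 + real i / real k) ^ i"
      using k by (simp add: power_mult_distrib[symmetric] field_simps)
    also have "\<dots> \<le> real k ^ i * exp (real i / real k) ^ i"
      by (intro mult_left_mono power_mono exp_ge_add_one_self) auto
    also have "exp (real i / real k) ^ i = exp (real i * real i / real k)"
      by (simp add: exp_of_nat_mult[symmetric])
    also have "\<dots> \<le> exp 1"
      using \<open>real i * real i \<le> real k\<close> k by simp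
    finally have "(real k + real i) ^ i \<le> real k ^ i * exp 1"
      by (simp add: mult_left_mono)
    then have "fact (k + i) \<le> fact k * (real k ^ i * exp 1)"
      by (intro order_trans[OF f] mult_left_mono) auto
    then have "real k ^ k / (fact k * exp 1) \<le> real k ^ (k + i) / fact (k + i)"
      using k by (simp add: field_simps power_add)
    from mult_right_mono[OF this, of "exp (- real k)"] show ?thesis
      using k by (simp add: mult_ac)
  qed
  have "sqrt (real k) * (?v k / exp 1) \<le> (\<Sum>i\<le>N. ?v k / exp 1)"
    using N by (simp add: mult_right_mono divide_right_mono)
  also have "\<dots> \<le> (\<Sum>i\<le>N. ?v (k + i))"
    by (intro sum_mono ratio) auto
  also have "\<dots> = (\<Sum>j\<in>{k..k + N}. ?v j)"
    by (rule sum.reindex_bij_witness[of _ "\<lambda>j. j - k" "\<lambda>i. k + i"]) auto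
  also have "\<dots> \<le> 1"
    by (simp add: measure_measure_pmf_finite[symmetric] del: pmf_poisson)
  finally have v: "?v k \<le> exp 1 / sqrt (real k)"
    using k by (simp add: field_simps del: pmf_poisson)
  \<comment> \<open>The k-th power of this inequality says that \<open>l ^ k * exp (- l)\<close> is
    largest at l = k.\<close>
  have "1 + (l / real k - 1) \<le> exp (l / real k - 1)"
    by (rule exp_ge_add_one_self)
  then have "(l / real k) ^ k \<le> exp (l / real k - 1) ^ k"
    using assms by (intro power_mono) auto
  also have "\<dots> = exp (l - real k)"
    using k by (simp add: exp_of_nat_mult[symmetric] field_simps)
  finally have "l ^ k * exp (- l) \<le> real k ^ k * exp (- real k)"
    using k by (simp add: power_divide field_simps exp_diff exp_minus)
  then have "pmf (poisson_pmf l) k \<le> ?v k"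
    using assms k by (simp add: divide_right_mono)
  with v show ?thesis by linarith
qed

text \<open>Taylor to fourth order gives x^2/2 - x^4/24, and x^2 \<le> 10 on the interval, so x^2
  (1/2 - 10/24) remains.\<close>

lemma one_minus_cos_ge:
  fixes x :: real
  assumes "\<bar>x\<bar> \<le> pi"
  shows "x\<^sup>2 / 12 \<le> 1 - cos x"
proof -
  obtain t where "cos x = (\<Sum>m<4. cos_coeff m * x ^ m) + cos (t + 1 / 2 * real 4 * pi) / fact 4 * x ^ 4"
    using Maclaurin_cos_expansion[of x 4] by blast
  also have "(\<Sum>m<4. cos_coeff m * x ^ m) = 1 - x\<^sup>2 / 2"
  proof -
    have "{..<4} = {0, 1, 2, 3 :: nat}" by auto
    then show ?thesis by (simp add: cos_coeff_def)
  qed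
  finally have "cos x = 1 - x\<^sup>2 / 2 + cos (t + 1 / 2 * real 4 * pi) / 24 * x ^ 4"
    by (simp add: fact_numeral)
  moreover have "cos (t + 1 / 2 * real 4 * pi) / 24 * x ^ 4 \<le> 1 / 24 * x ^ 4"
    by (intro mult_right_mono divide_right_mono) auto
  ultimately have *: "cos x \<le> 1 - x\<^sup>2 / 2 + x ^ 4 / 24" by simp
  have "\<bar>x\<bar> \<le> 63 / 20" using assms pi_approx by simp
  then have "\<bar>x\<bar>\<^sup>2 \<le> (63 / 20)\<^sup>2" by (intro power_mono) auto
  then have "x\<^sup>2 \<le> 10" by (simp add: power2_eq_square)
  then have "x\<^sup>2 * x\<^sup>2 \<le> 10 * x\<^sup>2" by (intro mult_right_mono) auto
  with * show ?thesis by (simp add: power4_eq_xxxx power2_eq_square field_simps)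
qed

section \<open>Bernoulli's inequality, tangents and quadratic bounds for powers\<close>

lemma powr_le_bernoulli:
  fixes x :: real
  assumes "x \<ge> 0" "0 < t" "t \<le> 1"
  shows "x powr t \<le> 1 + t * (x - 1)"
proof (cases "x = 0")
  case False
  with assms Youngs_inequality_0[of t "1 - t" x 1] show ?thesis
    by (simp add: algebra_simps)
qed (use assms in simp)

lemma powr_ge_bernoulli:
  fixes x :: real
  assumes "x \<ge> 0" "a \<ge> 1"
  shows "1 + a * (x - 1) \<le> x powr a"
proof -
  \<comment> \<open>The case of exponents above 1 is the previous inequality for the exponent 1/a at
    the point \<open>x powr a\<close>.\<close>
  have "(x powr a) powr (1 / a) \<le> 1 + 1 / a * (x powr a - 1)"
    using assms by (intro powr_le_bernoulli) auto
  then have "x \<le> 1 + (x powr a - 1) / a"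
    using assms by (simp add: powr_powr)
  then have "a * x \<le> a * (1 + (x powr a - 1) / a)"
    using assms by (intro mult_left_mono) auto
  also have "\<dots> = a + x powr a - 1"
    using assms by (simp add: distrib_left)
  finally show ?thesis by (simp add: right_diff_distrib)
qed

lemma powr_ge_tangent:
  fixes x y :: real
  assumes "x \<ge> 0" "y > 0" "a \<ge> 1"
  shows "y powr a + a * y powr (a - 1) * (x - y) \<le> x powr a"
proof -
  have "y powr a * (1 + a * (x / y - 1)) \<le> y powr a * (x / y) powr a"
    using assms by (intro mult_left_mono powr_ge_bernoulli) auto
  also have "\<dots> = x powr a"
    using assms by (simp add: powr_divide)
  also have "y powr a * (1 + a * (x / y - 1)) = y powr a + a * y powr (a - 1) * (x - y)"
    using assms by (simp add: powr_diff field_simps)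
  finally show ?thesis .
qed

text \<open>The tangent at x, evaluated at 1, reduces the claim to a first difference of
  \<open>x powr (a - 1)\<close>. As a - 1 may lie below 1, that difference is compared with the one
  of \<open>x powr a\<close>, where Bernoulli's inequality applies.\<close>

lemma powr_second_order_le:
  fixes x :: real
  assumes a: "a > 1" and x: "0 \<le> x" "x \<le> M" and M: "M \<ge> 1"
  shows "x powr a - 1 - a * (x - 1) \<le> a\<^sup>2 * M powr a * (x - 1)\<^sup>2"
proof (cases "x = 0")
  case True
  have "1 \<le> M powr a" using M a by (intro ge_one_powr_ge_zero) auto
  moreover have "a * 1 \<le> a * a" using a by (intro mult_left_mono) auto
  ultimately have "a * 1 * 1 \<le> a * a * M powr a" using a by (intro mult_mono) auto
  with True show ?thesis by (simp add: power2_eq_square)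
next
  case False
  with x have x0: "x > 0" by simp
  have "x powr a + a * x powr (a - 1) * (1 - x) \<le> 1 powr a"
    using x0 a by (intro powr_ge_tangent) auto
  then have "x powr a - 1 - a * (x - 1) \<le> a * ((x powr (a - 1) - 1) * (x - 1))"
    by (simp add: algebra_simps)
  also have "\<dots> \<le> a * (a * M powr a * (x - 1)\<^sup>2)"
  proof (intro mult_left_mono)
    show "(x powr (a - 1) - 1) * (x - 1) \<le> a * M powr a * (x - 1)\<^sup>2"
    proof (cases "x \<ge> 1")
      case True
      have "x powr (a - 1) - 1 \<le> x powr a - 1"
        using True by (simp add: powr_mono)
      also have "\<dots> \<le> a * x powr (a - 1) * (x - 1)"
        using powr_ge_tangent[of 1 x a] x0 a by (simp add: algebra_simps)
      also have "\<dots> \<le> a * M powr a * (x - 1)"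
      proof (intro mult_right_mono mult_left_mono)
        have "x powr (a - 1) \<le> x powr a" using True by (simp add: powr_mono)
        also have "\<dots> \<le> M powr a" using x a by (intro powr_mono2) auto
        finally show "x powr (a - 1) \<le> M powr a" .
      qed (use True a in auto)
      finally have "(x powr (a - 1) - 1) * (x - 1) \<le> a * M powr a * (x - 1) * (x - 1)"
        using True by (intro mult_right_mono) auto
      then show ?thesis by (simp add: power2_eq_square mult_ac)
    next
      case False
      have "1 - x powr (a - 1) \<le> 1 - x powr a"
        using False x0 by (simp add: powr_mono')
      also have "\<dots> \<le> a * (1 - x)"
        using powr_ge_bernoulli[of x a] x0 a by (simp add: algebra_simps)
      also have "\<dots> \<le> a * M powr a * (1 - x)"
        using False a M by (intro mult_right_mono) (auto intro: ge_one_powr_ge_zero)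
      finally have "(1 - x powr (a - 1)) * (1 - x) \<le> a * M powr a * (1 - x) * (1 - x)"
        using False by (intro mult_right_mono) auto
      then show ?thesis by (simp add: power2_eq_square algebra_simps)
    qed
  qed (use a in auto)
  finally show ?thesis by (simp add: power2_eq_square mult_ac)
qed

text \<open>Adding the tangent inequality at the midpoint of \<open>1\<close> and \<open>x\<close> to the one at \<open>1\<close> leaves a first
  difference of \<open>x powr (a - 1)\<close>.\<close>

lemma powr_second_order_ge:
  fixes x :: real
  assumes a: "a > 1" and x: "0 \<le> x" "x \<le> M" and M: "M \<ge> 1"
  shows "a * min 1 (a - 1) / (4 * M) * (x - 1)\<^sup>2 \<le> x powr a - 1 - a * (x - 1)"
proof -
  define y where "y = (1 + x) / 2"
  \<comment> \<open>An exponent at most 1 admits \<open>powr_le_bernoulli\<close>, and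
    \<open>y powr (a - 1)\<close> is at least as far from 1 as \<open>y powr t\<close>, on the same
    side.\<close>
  define t where "t = min 1 (a - 1)"
  have t: "0 < t" "t \<le> 1" "t \<le> a - 1" using a by (auto simp: t_def)
  have y: "y > 0" "y \<le> M" using x M by (auto simp: y_def)
  have first: "t / M * (y - 1)\<^sup>2 \<le> (y powr (a - 1) - 1) * (y - 1)"
  proof (cases "y \<ge> 1")
    case True
    \<comment> \<open>Bernoulli's inequality at 1/y bounds the reciprocal of \<open>y powr t\<close>
      by 1 - z; since (1 + z)(1 - z) \<le> 1, this inverts to a lower bound 1 + z.\<close>
    define z where "z = t * (1 - 1 / y)"
    have z: "0 \<le> z" using t True by (simp add: z_def)
    have "(1 / y) powr t \<le> 1 + t * (1 / y - 1)"
      using y t by (intro powr_le_bernoulli) auto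
    then have "inverse (y powr t) \<le> 1 - z"
      using y by (simp add: powr_divide z_def algebra_simps inverse_eq_divide)
    then have "(1 + z) * inverse (y powr t) \<le> (1 + z) * (1 - z)"
      using z by (intro mult_left_mono) auto
    also have "\<dots> \<le> 1" by (simp add: algebra_simps)
    finally have "1 + z \<le> y powr t"
      using y by (simp add: field_simps)
    also have "\<dots> \<le> y powr (a - 1)" using True t by (intro powr_mono) auto
    finally have "z \<le> y powr (a - 1) - 1" by simp
    moreover have "t / M * (y - 1) \<le> z"
    proof -
      have "z = t / y * (y - 1)" using y by (simp add: z_def field_simps)
      moreover have "t / M * (y - 1) \<le> t / y * (y - 1)"
        using y t True by (intro mult_right_mono divide_left_mono) auto
      ultimately show ?thesis by simp
    qed
    ultimately have "t / M * (y - 1) * (y - 1) \<le> (y powr (a - 1) - 1) * (y - 1)"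
      using True by (intro mult_right_mono) auto
    then show ?thesis by (simp add: power2_eq_square mult_ac)
  next
    case False
    have "y powr (a - 1) \<le> y powr t" using False y t by (intro powr_mono') auto
    also have "\<dots> \<le> 1 + t * (y - 1)" using y t by (intro powr_le_bernoulli) auto
    finally have "t * (1 - y) \<le> 1 - y powr (a - 1)" by (simp add: algebra_simps)
    moreover have "t / M * (1 - y) \<le> t * (1 - y)"
      using M t False by (intro mult_right_mono) (auto simp: field_simps)
    ultimately have "t / M * (1 - y) * (1 - y) \<le> (1 - y powr (a - 1)) * (1 - y)"
      using False by (intro mult_right_mono) auto
    then have "t / M * (1 - y)\<^sup>2 \<le> (1 - y powr (a - 1)) * (1 - y)"
      by (simp only: power2_eq_square mult.assoc)
    also have "\<dots> = (y powr (a - 1) - 1) * (y - 1)" by (simp add: algebra_simps)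
    finally show ?thesis by (simp only: power2_commute)
  qed
  have "y powr a + a * y powr (a - 1) * (x - y) \<le> x powr a"
    using x y a by (intro powr_ge_tangent) auto
  moreover have "1 + a * (y - 1) \<le> y powr a"
    using y a by (intro powr_ge_bernoulli) auto
  ultimately have "a * ((y powr (a - 1) - 1) * (x - y)) \<le> x powr a - 1 - a * (x - 1)"
    by (simp add: algebra_simps)
  moreover have "x - y = y - 1" by (simp add: y_def field_simps)
  moreover have "a * (t / M * (y - 1)\<^sup>2) \<le> a * ((y powr (a - 1) - 1) * (y - 1))"
    using first a by (intro mult_left_mono) auto
  moreover have "a * (t / M * (y - 1)\<^sup>2) = a * t / (4 * M) * (x - 1)\<^sup>2"
  proof -
    have y1: "y - 1 = (x - 1) / 2" by (simp add: y_def field_simps)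
    show ?thesis unfolding y1 by (simp add: power_divide)
  qed
  ultimately show ?thesis by (simp add: t_def)
qed

lemma card_nat_ball_le:
  assumes "finite A" "\<And>k. k \<in> A \<Longrightarrow> \<bar>real k - c\<bar> \<le> d" "d \<ge> 0"
  shows "real (card A) \<le> 2 * d + 1"
proof (cases "A = {}")
  case False
  have "A \<subseteq> {Min A..Max A}" using assms(1) by auto
  then have "card A \<le> card {Min A..Max A}" by (intro card_mono) auto
  moreover have "Min A \<le> Max A" "\<bar>real (Min A) - c\<bar> \<le> d" "\<bar>real (Max A) - c\<bar> \<le> d"
    using assms False by auto
  ultimately show ?thesis by simp
qed (use assms in simp)

section \<open>The likelihood ratio\<close>

text \<open>The squared modulus is exactly D^2 - 2 p (1 - p) r (1 - cos \<theta>). The coefficient p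
  (1 - p) r / D^2 is the variance of the tilted variable, whose success probability is p r /
  D.\<close>

lemma norm_bernoulli_gf_factor_le:
  fixes p r \<theta> :: real
  assumes "0 \<le> p" "p \<le> 1" "r > 0"
  defines "D \<equiv> 1 - p + p * r"
  shows "norm (of_real (1 - p) + of_real p * (of_real r * cis \<theta>)) \<le>
    D * exp (- (p * (1 - p) * r / D\<^sup>2) * (1 - cos \<theta>))"
proof (rule power2_le_imp_le)
  have D: "D > 0"
  proof (cases "p = 1")
    case False
    with assms show ?thesis unfolding D_def by (intro add_pos_nonneg) auto
  qed (use assms in \<open>simp add: D_def\<close>)
  let ?u = "p * (1 - p) * r / D\<^sup>2 * (1 - cos \<theta>)"
  have "(norm (of_real (1 - p) + of_real p * (of_real r * cis \<theta>)))\<^sup>2 =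
      (1 - p + p * (r * cos \<theta>))\<^sup>2 + (p * (r * sin \<theta>))\<^sup>2"
    by (simp add: cmod_power2)
  also have "\<dots> = D\<^sup>2 - 2 * (p * (1 - p) * r * (1 - cos \<theta>))"
  proof -
    have "(p * (r * sin \<theta>))\<^sup>2 = p\<^sup>2 * r\<^sup>2 * (1 - (cos \<theta>)\<^sup>2)"
      by (simp add: power_mult_distrib sin_squared_eq)
    then show ?thesis
      unfolding D_def by (simp add: power2_eq_square algebra_simps)
  qed
  also have "\<dots> = D\<^sup>2 * (1 + - 2 * ?u)"
    using D by (simp add: field_simps)
  also have "\<dots> \<le> D\<^sup>2 * exp (- 2 * ?u)"
    by (intro mult_left_mono exp_ge_add_one_self) auto
  also have "exp (- 2 * ?u) = (exp (- (p * (1 - p) * r / D\<^sup>2) * (1 - cos \<theta>)))\<^sup>2"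
    by (simp add: power2_eq_square exp_add[symmetric])
  also have "D\<^sup>2 * \<dots> = (D * exp (- (p * (1 - p) * r / D\<^sup>2) * (1 - cos \<theta>)))\<^sup>2"
    by (simp add: power_mult_distrib)
  finally show "(norm (of_real (1 - p) + of_real p * (of_real r * cis \<theta>)))\<^sup>2 \<le> \<dots>" .
  show "0 \<le> D * exp (- (p * (1 - p) * r / D\<^sup>2) * (1 - cos \<theta>))"
    using D by simp
qed

lemma has_integral_cos_mult_diff:
  fixes j k :: nat
  shows "((\<lambda>\<theta>. cos ((real j - real k) * \<theta>)) has_integral (if j = k then 2 * pi else 0)) {- pi..pi}"
proof (cases "j = k")
  case True
  then show ?thesis
    using has_integral_const_real[of "1::real" "- pi" pi] by simp
next
  case False
  define m where "m = real j - real k"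
  have m: "m \<noteq> 0" using False by (simp add: m_def)
  have "sin (m * pi) = 0"
    using sin_zero_iff_int2[of "m * pi"]
    by (auto simp: m_def intro!: exI[of _ "int j - int k"])
  moreover have "((\<lambda>\<theta>. cos (m * \<theta>)) has_integral (sin (m * pi) / m - sin (m * (- pi)) / m)) {- pi..pi}"
    using m by (intro fundamental_theorem_of_calculus)
      (auto intro!: derivative_eq_intros simp: has_real_derivative_iff_has_vector_derivative[symmetric])
  ultimately show ?thesis using False by (simp add: m_def)
qed

text \<open>Integrating the generating function over the circle of radius \<open>r\<close> bounds the point
  probabilities of the exponentially tilted sum, whose variance is the sum under the root.\<close>

lemma bernoulli_sum_pmf_tilted_le:
  fixes p :: "nat \<Rightarrow> real"
  assumes p: "\<forall>j\<in>{1..n}. p j \<in> {0..1}" and r: "r > 0"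
  shows "pmf (bernoulli_sum_pmf n p) k * r ^ k *
      sqrt (\<Sum>j=1..n. p j * (1 - p j) * r / (1 - p j + p j * r)\<^sup>2) \<le>
    2 * (\<Prod>j=1..n. 1 - p j + p j * r)"
proof -
  let ?w = "pmf (bernoulli_sum_pmf n p)"
  define D where "D j = 1 - p j + p j * r" for j
  define P where "P = (\<Prod>j=1..n. D j)"
  define V where "V = (\<Sum>j=1..n. p j * (1 - p j) * r / (D j)\<^sup>2)"
  have P: "P \<ge> 0"
    unfolding P_def D_def using p r by (intro prod_nonneg) auto
  have V: "V \<ge> 0"
    unfolding V_def using p r by (intro sum_nonneg divide_nonneg_nonneg mult_nonneg_nonneg) auto
  have "?w k * r ^ k * sqrt V \<le> 2 * P"
  proof (cases "V = 0 \<or> k > n")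
    case True
    then show ?thesis using P p by (auto simp: pmf_bernoulli_sum_eq_0)
  next
    case False
    then have V: "V > 0" and k: "k \<le> n" using V by auto
    \<comment> \<open>The real part of the generating function on the circle, rotated by - k
      \<theta>: integration leaves only the term j = k.\<close>
    define h where "h \<theta> = (\<Sum>j\<le>n. ?w j * r ^ j * cos ((real j - real k) * \<theta>))" for \<theta>
    have h_int: "(h has_integral (2 * pi * (?w k * r ^ k))) {- pi..pi}"
    proof -
      have "(h has_integral (\<Sum>j\<le>n. ?w j * r ^ j * (if j = k then 2 * pi else 0))) {- pi..pi}"
        unfolding h_def
        by (intro has_integral_sum has_integral_mult_right has_integral_cos_mult_diff) auto
      also have "(\<Sum>j\<le>n. ?w j * r ^ j * (if j = k then 2 * pi else 0)) = 2 * pi * (?w k * r ^ k)"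
        using k by (simp add: if_distrib[of "\<lambda>x. _ * x"] cong: if_cong)
      finally show ?thesis .
    qed
    \<comment> \<open>Then (a \<theta>)^2 = V \<theta>^2 / 12 is the lower bound for V (1 - cos
      \<theta>), and exp (- u) \<le> 1 / (1 + u) leaves an integrand with antiderivative
      arctan.\<close>
    define a where "a = sqrt (V / 12)"
    have a: "a > 0" "a\<^sup>2 = V / 12" using V by (auto simp: a_def)
    have h_le: "h \<theta> \<le> P / (1 + (a * \<theta>)\<^sup>2)" if "\<theta> \<in> {- pi..pi}" for \<theta>
    proof -
      let ?z = "of_real r * cis \<theta> :: complex"
      have "h \<theta> = Re (cis (- real k * \<theta>) * (\<Sum>j\<le>n. ?w j *\<^sub>R ?z ^ j))"
        unfolding h_def sum_distrib_left Re_sum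
      proof (intro sum.cong refl)
        fix j
        have "cis (- real k * \<theta>) * cis \<theta> ^ j = cis ((real j - real k) * \<theta>)"
          by (simp only: Complex.DeMoivre cis_mult) (simp add: algebra_simps)
        then have "cis (- real k * \<theta>) * (?w j *\<^sub>R ?z ^ j) =
            of_real (?w j * r ^ j) * cis ((real j - real k) * \<theta>)"
          by (simp add: scaleR_conv_of_real power_mult_distrib)
        then show "?w j * r ^ j * cos ((real j - real k) * \<theta>) =
            Re (cis (- real k * \<theta>) * (?w j *\<^sub>R ?z ^ j))"
          by simp
      qed
      also have "\<dots> \<le> norm (cis (- real k * \<theta>) * (\<Sum>j\<le>n. ?w j *\<^sub>R ?z ^ j))"
        by (rule complex_Re_le_cmod)
      also have "\<dots> = (\<Prod>j=1..n. norm (of_real (1 - p j) + of_real (p j) * ?z))"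
        by (simp only: bernoulli_sum_gf[OF p] norm_mult norm_cis prod_norm mult_1)
      also have "\<dots> \<le> (\<Prod>j=1..n. D j * exp (- (p j * (1 - p j) * r / (D j)\<^sup>2) * (1 - cos \<theta>)))"
        unfolding D_def using p r
        by (intro prod_mono conjI norm_bernoulli_gf_factor_le norm_ge_zero) auto
      also have "\<dots> = P * exp (- V * (1 - cos \<theta>))"
        unfolding P_def V_def prod.distrib
        by (simp add: exp_sum[symmetric] sum_negf sum_distrib_right)
      also have "\<dots> \<le> P * (1 / (1 + (a * \<theta>)\<^sup>2))"
      proof (intro mult_left_mono P)
        have "V * (\<theta>\<^sup>2 / 12) \<le> V * (1 - cos \<theta>)"
          using V that by (intro mult_left_mono one_minus_cos_ge) auto
        then have "1 + (a * \<theta>)\<^sup>2 \<le> exp (V * (1 - cos \<theta>))"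
          unfolding power_mult_distrib a
          using exp_ge_add_one_self[of "V * (1 - cos \<theta>)"] by linarith
        moreover have "1 + (a * \<theta>)\<^sup>2 > 0" by (simp add: add_pos_nonneg)
        ultimately show "exp (- V * (1 - cos \<theta>)) \<le> 1 / (1 + (a * \<theta>)\<^sup>2)"
          by (simp only: mult_minus_left exp_minus inverse_eq_divide[symmetric] le_imp_inverse_le)
      qed
      finally show ?thesis by simp
    qed
    have "((\<lambda>\<theta>. P / (1 + (a * \<theta>)\<^sup>2)) has_integral
        (P / a * arctan (a * pi) - P / a * arctan (a * - pi))) {- pi..pi}"
    proof (rule fundamental_theorem_of_calculus)
      fix \<theta>
      have "((\<lambda>\<theta>. P / a * arctan (a * \<theta>)) has_real_derivative
          (P / a * (inverse (1 + (a * \<theta>)\<^sup>2) * a))) (at \<theta> within {- pi..pi})"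
        by (auto intro!: derivative_eq_intros)
      moreover have "P / a * (y * a) = P * y" for y
        using a by simp
      ultimately show "((\<lambda>\<theta>. P / a * arctan (a * \<theta>)) has_vector_derivative P / (1 + (a * \<theta>)\<^sup>2))
          (at \<theta> within {- pi..pi})"
        by (simp only: has_real_derivative_iff_has_vector_derivative divide_inverse)
    qed simp
    then have "2 * pi * (?w k * r ^ k) \<le> P / a * arctan (a * pi) - P / a * arctan (a * - pi)"
      by (rule has_integral_le[OF h_int]) (rule h_le)
    also have "\<dots> = P / a * (2 * arctan (a * pi))"
      by (simp add: arctan_minus)
    also have "\<dots> \<le> P / a * pi"
      using arctan_ubound[of "a * pi"] P a by (intro mult_left_mono) auto
    finally have "2 * (?w k * r ^ k) * a \<le> P"
      using a by (simp add: field_simps)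
    \<comment> \<open>\<open>sqrt V\<close> is sqrt 12 times \<open>a\<close>, and sqrt 12 is
      rounded up to 4.\<close>
    moreover have "?w k * r ^ k * sqrt V \<le> ?w k * r ^ k * (4 * a)"
    proof -
      have "sqrt V \<le> 4 * a"
        using V a by (intro real_le_lsqrt) (auto simp: power_mult_distrib)
      then show ?thesis using r by (intro mult_left_mono) auto
    qed
    ultimately show ?thesis by simp
  qed
  then show ?thesis by (simp add: P_def V_def D_def)
qed

text \<open>The constant below 1 is the point: (1 + x) exp (- x) \<le> exp (- x/4) once x \<ge>
  1.\<close>

lemma one_plus_le_exp_three_quarters:
  fixes x :: real
  assumes "x \<ge> 1"
  shows "1 + x \<le> exp (3 / 4 * x)"
proof -
  have "x \<le> x\<^sup>2" using assms by (simp add: power2_eq_square)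
  have "1 + x \<le> 1 + 3 / 4 * x + (3 / 4 * x)\<^sup>2 / 2"
  proof -
    have "(3 / 4 * x)\<^sup>2 / 2 = 9 / 32 * x\<^sup>2" by (simp add: power2_eq_square)
    with \<open>x \<le> x\<^sup>2\<close> assms show ?thesis by linarith
  qed
  also have "\<dots> \<le> exp (3 / 4 * x)"
    using assms exp_lower_Taylor_quadratic[of "3 / 4 * x"] by simp
  finally show ?thesis .
qed

text \<open>At r = k / l the numbers p_j (r - 1) add up to k - l, so the generating function times
  exp (l - k) is the product of compensated factors, and Stirling's formula replaces k! / k^k.
  \<open>B\<close> bounds the tilted point probability; it is used with 1 and with 2 / sqrt
  V.\<close>

lemma bernoulli_sum_ratio_le_tilted:
  fixes p :: "nat \<Rightarrow> real"
  assumes p: "\<forall>j\<in>{1..n}. p j \<in> {0..1}" and l: "l = (\<Sum>j=1..n. p j)" "l > 0" and k: "k \<ge> 1"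
    and r: "r = real k / l"
    and B: "pmf (bernoulli_sum_pmf n p) k * r ^ k \<le> (\<Prod>j=1..n. 1 - p j + p j * r) * B"
  shows "pmf (bernoulli_sum_pmf n p) k / pmf (poisson_pmf l) k \<le>
    exp 1 * sqrt (real k) * (\<Prod>j=1..n. (1 + p j * (r - 1)) * exp (- (p j * (r - 1)))) * B"
proof -
  let ?w = "pmf (bernoulli_sum_pmf n p) k"
  let ?P = "\<Prod>j=1..n. 1 - p j + p j * r"
  have kp: "real k > 0" using k by simp
  have "(\<Sum>j=1..n. p j * (r - 1)) = l * (r - 1)"
    unfolding l(1) by (simp only: sum_distrib_right)
  also have "\<dots> = real k - l"
    using l(2) by (simp add: r right_diff_distrib)
  finally have sx: "(\<Sum>j=1..n. p j * (r - 1)) = real k - l" .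
  have "1 + p j * (r - 1) = 1 - p j + p j * r" for j
    by (simp add: algebra_simps)
  moreover have "(\<Prod>j=1..n. exp (- (p j * (r - 1)))) = exp (l - real k)"
    by (simp only: exp_sum[symmetric] finite_atLeastAtMost sum_negf sx minus_diff_eq)
  ultimately have E: "(\<Prod>j=1..n. (1 + p j * (r - 1)) * exp (- (p j * (r - 1)))) = ?P * exp (l - real k)"
    by (simp only: prod.distrib)
  have "?w / pmf (poisson_pmf l) k = ?w * r ^ k * (fact k * exp l / real k ^ k)"
    using l kp by (simp add: r field_simps exp_minus power_divide)
  also have "\<dots> \<le> (?P * B) * ((exp 1 * sqrt (real k) * real k ^ k * exp (- real k)) * exp l / real k ^ k)"
  proof (rule mult_mono[OF B])
    show "fact k * exp l / real k ^ k \<le>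
        exp 1 * sqrt (real k) * real k ^ k * exp (- real k) * exp l / real k ^ k"
      using fact_le_stirling[OF k] by (intro divide_right_mono mult_right_mono) auto
    have "0 \<le> ?w * r ^ k" using l kp by (simp add: r)
    with B show "0 \<le> ?P * B" by linarith
  qed auto
  also have "\<dots> = exp 1 * sqrt (real k) * (?P * exp (l - real k)) * B"
    using kp by (simp add: exp_diff exp_minus field_simps)
  finally show ?thesis unfolding E .
qed

text \<open>Three regimes for k \<ge> 1. For r \<le> 3 the tilted variance V is at least r (l - l2)
  / 9. For r > 3, either indices with p_j (r - 1) \<le> 1 carry half of l and V \<ge> k/16, or the
  other indices do and the compensated factors decay exponentially in k.\<close>

lemma bernoulli_sum_ratio_le:
  fixes p :: "nat \<Rightarrow> real"
  assumes p: "\<forall>j\<in>{1..n}. p j \<in> {0..1}" and l: "l = (\<Sum>j=1..n. p j)" "l > 0"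
    and l2: "l2 = (\<Sum>j=1..n. (p j)\<^sup>2)"
  shows "pmf (bernoulli_sum_pmf n p) k / pmf (poisson_pmf l) k \<le>
    8 * exp 1 * sqrt (max 1 l / max 1 (l - l2))"
proof -
  let ?w = "pmf (bernoulli_sum_pmf n p)"
  define F where "F = max 1 l / max 1 (l - l2)"
  have l2_nonneg: "l2 \<ge> 0" unfolding l2 by (intro sum_nonneg) auto
  have F: "F \<ge> 1" unfolding F_def using l2_nonneg by (auto simp: field_simps)
  have e: "exp (1::real) \<ge> 1" by simp
  have ge: "8 * exp 1 \<le> 8 * exp 1 * sqrt F"
    using F by (simp add: mult_le_cancel_left)
  have "?w k / pmf (poisson_pmf l) k \<le> 8 * exp 1 * sqrt F"
  proof (cases "k = 0")
    case True
    have "?w 0 = (\<Prod>j=1..n. 1 - p j)"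
      using bernoulli_sum_gf[OF p, of "0::real"]
      by (simp add: if_distrib[of "\<lambda>x. _ * x"] power_0_left cong: if_cong)
    also have "\<dots> \<le> (\<Prod>j=1..n. exp (- p j))"
      using p exp_ge_add_one_self[of "- p j" for j] by (intro prod_mono) auto
    also have "\<dots> = exp (- l)"
      by (simp add: l exp_sum[symmetric] sum_negf)
    finally have "?w 0 / pmf (poisson_pmf l) 0 \<le> 1"
      using l(2) by simp
    also have "1 \<le> 8 * exp (1::real)" using e by linarith
    finally show ?thesis using ge unfolding True by linarith
  next
    case False
    then have k: "k \<ge> 1" by simp
    then have kp: "real k > 0" by simp
    define r where "r = real k / l"
    have r: "r > 0" and rl: "r * l = real k" using l kp by (auto simp: r_def)
    define D where "D j = 1 - p j + p j * r" for j
    define Q where "Q j = (1 + p j * (r - 1)) * exp (- (p j * (r - 1)))" for j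
    define V where "V = (\<Sum>j=1..n. p j * (1 - p j) * r / (D j)\<^sup>2)"
    have D: "D j > 0" if "j \<in> {1..n}" for j
    proof (cases "p j = 1")
      case False
      with p that r show ?thesis unfolding D_def by (intro add_pos_nonneg) (auto simp: less_le)
    qed (use r in \<open>simp add: D_def\<close>)
    have terms: "p j * (1 - p j) * r / (D j)\<^sup>2 \<ge> 0" if "j \<in> {1..n}" for j
      using p that r by (intro divide_nonneg_nonneg mult_nonneg_nonneg) auto
    have V: "V \<ge> 0" unfolding V_def by (intro sum_nonneg terms)
    have DQ: "D j = 1 + p j * (r - 1)" for j by (simp add: D_def algebra_simps)
    have Q: "0 \<le> Q j" "Q j \<le> 1" if "j \<in> {1..n}" for j
    proof -
      show "0 \<le> Q j" unfolding Q_def DQ[symmetric] using D[OF that] by simp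
      have "Q j \<le> exp (p j * (r - 1)) * exp (- (p j * (r - 1)))"
        unfolding Q_def by (intro mult_right_mono exp_ge_add_one_self) auto
      then show "Q j \<le> 1" by (simp add: exp_add[symmetric])
    qed
    have prodQ: "0 \<le> (\<Prod>j=1..n. Q j)" "(\<Prod>j=1..n. Q j) \<le> 1"
      using Q by (auto intro!: prod_nonneg prod_le_1)
    have bound1: "?w k / pmf (poisson_pmf l) k \<le> exp 1 * sqrt (real k) * (\<Prod>j=1..n. Q j)"
    proof -
      have "?w k * r ^ k \<le> (\<Sum>i\<le>n. ?w i * r ^ i)" if "k \<le> n"
        using that r by (intro member_le_sum) auto
      moreover have "(\<Sum>i\<le>n. ?w i * r ^ i) = (\<Prod>j=1..n. D j)"
        using bernoulli_sum_gf[OF p, of r] by (simp add: D_def)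
      moreover have "0 \<le> (\<Prod>j=1..n. D j)" using D by (intro prod_nonneg) (auto intro: less_imp_le)
      ultimately have "?w k * r ^ k \<le> (\<Prod>j=1..n. D j) * 1"
        using pmf_bernoulli_sum_eq_0[OF p, of k] by (cases "k \<le> n") auto
      from bernoulli_sum_ratio_le_tilted[OF p l k r_def this[unfolded D_def]]
      show ?thesis by (simp add: Q_def)
    qed
    have bound2: "?w k / pmf (poisson_pmf l) k \<le> exp 1 * sqrt (real k) * (2 / sqrt V)" if "V > 0"
    proof -
      have "?w k * r ^ k * sqrt V \<le> 2 * (\<Prod>j=1..n. D j)"
        using bernoulli_sum_pmf_tilted_le[OF p r] unfolding V_def D_def .
      then have "?w k * r ^ k \<le> (\<Prod>j=1..n. D j) * (2 / sqrt V)"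
        using that by (simp add: field_simps)
      from bernoulli_sum_ratio_le_tilted[OF p l k r_def this[unfolded D_def]]
      have "?w k / pmf (poisson_pmf l) k \<le> exp 1 * sqrt (real k) * (\<Prod>j=1..n. Q j) * (2 / sqrt V)"
        by (simp add: Q_def)
      also have "\<dots> \<le> exp 1 * sqrt (real k) * 1 * (2 / sqrt V)"
        using prodQ that by (intro mult_right_mono mult_left_mono) auto
      finally show ?thesis by simp
    qed
    show ?thesis
    proof (cases "r \<le> 3")
      case True
      \<comment> \<open>Since p_j \<le> 1 and r \<le> 3, every \<open>D j\<close> is at most
        3.\<close>
      have Vge: "r * (l - l2) / 9 \<le> V"
      proof -
        have "l - l2 = (\<Sum>j=1..n. p j * (1 - p j))"
          unfolding l(1) l2 by (simp add: sum_subtractf[symmetric] power2_eq_square right_diff_distrib)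
        then have "r * (l - l2) / 9 = (\<Sum>j=1..n. p j * (1 - p j)) * r / 9"
          by (simp only: mult.commute)
        also have "\<dots> = (\<Sum>j=1..n. p j * (1 - p j) * r / 9)"
          by (simp only: sum_distrib_right sum_divide_distrib)
        also have "\<dots> \<le> V"
          unfolding V_def
        proof (intro sum_mono divide_left_mono)
          fix j assume j: "j \<in> {1..n}"
          have "p j * r \<le> p j * 3" using p j True by (intro mult_left_mono) auto
          moreover have "0 \<le> p j" "p j \<le> 1" using p j by auto
          ultimately have "D j \<le> 3" unfolding D_def by linarith
          then have "(D j)\<^sup>2 \<le> 3\<^sup>2" using D[OF j] by (intro power_mono) auto
          then show "(D j)\<^sup>2 \<le> 9" by simp
          show "0 \<le> p j * (1 - p j) * r" using p j r by auto
          show "0 < 9 * (D j)\<^sup>2" using D[OF j] by simp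
        qed
        finally show ?thesis .
      qed
      have sqk: "sqrt (real k) = sqrt r * sqrt l" by (simp only: rl[symmetric] real_sqrt_mult)
      have "sqrt r \<le> sqrt (2\<^sup>2)" using True by (intro real_sqrt_le_mono) simp
      then have sqr: "sqrt r \<le> 2" by simp
      show ?thesis
      \<comment> \<open>If the variance is at most 1, then F = max 1 l already controls sqrt k, and
        bounding the tilted probability by 1 suffices.\<close>
      proof (cases "l - l2 \<le> 1")
        case True
        then have "F = max 1 l" by (simp add: F_def)
        then have "sqrt (real k) \<le> 2 * sqrt F"
          unfolding sqk using l(2) sqr by (intro mult_mono real_sqrt_le_mono) auto
        then have "exp 1 * sqrt (real k) \<le> exp 1 * (2 * sqrt F)"
          by (intro mult_left_mono) auto
        moreover have "exp 1 * sqrt (real k) * (\<Prod>j=1..n. Q j) \<le> exp 1 * sqrt (real k) * 1"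
          using prodQ by (intro mult_left_mono) auto
        ultimately have "?w k / pmf (poisson_pmf l) k \<le> exp 1 * (2 * sqrt F)"
          using bound1 by linarith
        also have "\<dots> \<le> 8 * exp 1 * sqrt F" using F by simp
        finally show ?thesis .
      next
        case False
        then have "0 < r * (l - l2) / 9" using r by simp
        with Vge have V: "V > 0" by linarith
        have "sqrt (r * (l - l2)) / 3 = sqrt (r * (l - l2) / 3\<^sup>2)"
          by (simp only: real_sqrt_divide real_sqrt_abs abs_numeral)
        also have "\<dots> \<le> sqrt V" using Vge by (intro real_sqrt_le_mono) simp
        finally have "sqrt r * sqrt (l - l2) \<le> 3 * sqrt V"
          by (simp add: real_sqrt_mult)
        moreover have "sqrt F * sqrt (l - l2) = sqrt l"
          using False l2_nonneg by (simp add: F_def real_sqrt_mult[symmetric] max_def)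
        moreover from calculation have "sqrt F * (sqrt r * sqrt (l - l2)) \<le> sqrt F * (3 * sqrt V)"
          using F by (intro mult_left_mono) auto
        ultimately have "sqrt (real k) \<le> 3 * sqrt F * sqrt V"
          unfolding sqk by (metis mult.assoc mult.commute)
        then have "sqrt (real k) * (2 / sqrt V) \<le> 6 * sqrt F"
          using V by (simp add: field_simps)
        moreover have "0 \<le> sqrt F" using F by simp
        ultimately have "sqrt (real k) * (2 / sqrt V) \<le> 8 * sqrt F" by linarith
        then have "exp 1 * (sqrt (real k) * (2 / sqrt V)) \<le> exp 1 * (8 * sqrt F)"
          by (intro mult_left_mono) auto
        with bound2[OF V] show ?thesis unfolding mult.assoc by linarith
      qed
    next
      case False
      then have r3: "r > 3" by simp
      \<comment> \<open>On \<open>A\<close>, D_j \<le> 2, and r - 1 > 2 forces p_j \<le> 1/2, so the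
        variance term is at least p_j r / 8. Off \<open>A\<close>, the factor \<open>Q j\<close> is
        at most exp (- p_j (r - 1) / 4).\<close>
      define A where "A = {j\<in>{1..n}. p j * (r - 1) \<le> 1}"
      define B where "B = {1..n} - A"
      have split: "l = sum p A + sum p B"
        unfolding l B_def by (subst sum.subset_diff[of A "{1..n}"]) (auto simp: A_def)
      show ?thesis
      proof (cases "sum p A \<ge> l / 2")
        case True
        have "real k / 16 = r * (l / 2) / 8" using rl by simp
        also have "\<dots> \<le> r * sum p A / 8"
          using True r by (intro divide_right_mono mult_left_mono) auto
        also have "\<dots> = (\<Sum>j\<in>A. p j * r / 8)"
          by (simp add: sum_distrib_left sum_divide_distrib mult.commute)
        also have "\<dots> \<le> (\<Sum>j\<in>A. p j * (1 - p j) * r / (D j)\<^sup>2)"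
        proof (intro sum_mono)
          fix j assume "j \<in> A"
          then have j: "j \<in> {1..n}" and x: "p j * (r - 1) \<le> 1" by (auto simp: A_def)
          have p0: "p j \<ge> 0" using p j by auto
          have "p j * 2 \<le> p j * (r - 1)" using r3 p0 by (intro mult_left_mono) auto
          with x have "p j \<le> 1 / 2" by simp
          then have "p j * r * (1 / 2) \<le> p j * r * (1 - p j)"
            using p0 r by (intro mult_left_mono) auto
          moreover have "(D j)\<^sup>2 \<le> 2\<^sup>2"
            using x D[OF j] by (intro power_mono) (auto simp: DQ)
          moreover have "p j * r \<ge> 0" using p0 r by simp
          ultimately have "p j * r * (1 / 2) / 4 \<le> p j * r * (1 - p j) / (D j)\<^sup>2"
            using D[OF j] by (intro frac_le) auto
          then show "p j * r / 8 \<le> p j * (1 - p j) * r / (D j)\<^sup>2"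
            by (simp add: mult_ac)
        qed
        also have "\<dots> \<le> V"
          unfolding V_def using terms by (intro sum_mono2) (auto simp: A_def)
        finally have Vk: "real k / 4\<^sup>2 \<le> V" by simp
        moreover have "0 < real k / 4\<^sup>2" using kp by simp
        ultimately have Vpos: "V > 0" by linarith
        have "sqrt (real k) / 4 = sqrt (real k / 4\<^sup>2)"
          by (simp only: real_sqrt_divide real_sqrt_abs abs_numeral)
        also have "\<dots> \<le> sqrt V" using Vk by (rule real_sqrt_le_mono)
        finally have "sqrt (real k) * (2 / sqrt V) \<le> 8"
          using Vpos by (simp add: field_simps)
        then have "exp 1 * (sqrt (real k) * (2 / sqrt V)) \<le> exp 1 * 8"
          by (intro mult_left_mono) auto
        with bound2[OF Vpos] ge show ?thesis unfolding mult.assoc by linarith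
      next
        case False
        then have B2: "sum p B \<ge> l / 2" using split by simp
        have "(\<Prod>j=1..n. Q j) \<le> (\<Prod>j=1..n. if j \<in> B then exp (- (1 / 4) * (p j * (r - 1))) else 1)"
        proof (intro prod_mono conjI)
          fix j assume j: "j \<in> {1..n}"
          then show "0 \<le> Q j" using Q by auto
          show "Q j \<le> (if j \<in> B then exp (- (1 / 4) * (p j * (r - 1))) else 1)"
          proof (cases "j \<in> B")
            case True
            then have "p j * (r - 1) \<ge> 1" by (auto simp: A_def B_def)
            then have "Q j \<le> exp (3 / 4 * (p j * (r - 1))) * exp (- (p j * (r - 1)))"
              unfolding Q_def by (intro mult_right_mono one_plus_le_exp_three_quarters) auto
            then show ?thesis using True by (simp add: exp_add[symmetric])
          qed (use Q[OF j] in auto)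
        qed
        also have "\<dots> = (\<Prod>j\<in>B. exp (- (1 / 4) * (p j * (r - 1))))"
          by (subst prod.inter_restrict[symmetric]) (auto intro!: prod.cong simp: B_def)
        also have "\<dots> = exp (- (1 / 4) * (r - 1) * sum p B)"
          unfolding sum_distrib_left
          by (subst exp_sum[symmetric]) (auto simp: B_def intro!: sum.cong)
        also have "\<dots> \<le> exp (- (real k / 12))"
        proof -
          \<comment> \<open>For r > 3 one has r - 1 \<ge> 2r/3, and \<open>B\<close> carries at
            least l / 2.\<close>
          have "real k / 3 = (2 / 3 * r) * (l / 2)"
            unfolding rl[symmetric] by argo
          also have "\<dots> \<le> (r - 1) * sum p B"
            using r3 B2 l(2) by (intro mult_mono) auto
          finally have "- (1 / 4) * ((r - 1) * sum p B) \<le> - (real k / 12)" by linarith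
          then show ?thesis unfolding mult.assoc exp_le_cancel_iff .
        qed
        finally have "exp 1 * sqrt (real k) * (\<Prod>j=1..n. Q j) \<le>
            exp 1 * sqrt (real k) * exp (- (real k / 12))"
          by (intro mult_left_mono) auto
        also have "\<dots> \<le> 8 * exp 1"
        proof -
          have "real k \<le> 8\<^sup>2 * exp (real k / 6)"
            using exp_ge_add_one_self[of "real k / 6"] kp unfolding power2_eq_square by linarith
          also have "\<dots> = (8 * exp (real k / 12))\<^sup>2"
            by (simp add: power_mult_distrib exp_double[symmetric])
          finally have "sqrt (real k) \<le> 8 * exp (real k / 12)"
            by (simp add: real_le_lsqrt)
          then have "exp 1 * sqrt (real k) * exp (- (real k / 12)) \<le>
              exp 1 * (8 * exp (real k / 12)) * exp (- (real k / 12))"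
            by (intro mult_left_mono mult_right_mono) auto
          also have "\<dots> = 8 * exp 1"
            by (simp add: exp_minus)
          finally show ?thesis .
        qed
        finally show ?thesis using bound1 ge by linarith
      qed
    qed
  qed
  then show ?thesis by (simp add: F_def)
qed

section \<open>Charlier polynomials\<close>

text \<open>The Charlier polynomial of degree \<open>m\<close> at the point \<open>j\<close>,
  normalised to 1 at 0, given by its forward difference in the point. The truncated
  \<open>m - 1\<close> at m = 0 is harmless because its coefficient vanishes.\<close>

fun charlier :: "real \<Rightarrow> nat \<Rightarrow> nat \<Rightarrow> real" where
  "charlier l 0 m = 1"
| "charlier l (Suc j) m = charlier l j m - real m / l * charlier l j (m - 1)"

lemma charlier_at_0 [simp]: "charlier l j 0 = 1"
  by (induction j) auto

text \<open>Self-duality: degree and point play symmetric roles, so the defining recursion also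
  holds in the degree.\<close>

lemma charlier_Suc_right:
  "charlier l j (Suc m) = charlier l j m - real j / l * charlier l (j - 1) m"
proof (induction j arbitrary: m)
  case (Suc j)
  have "real m * charlier l j m =
      real m * charlier l j (m - 1) - real m * (real j / l) * charlier l (j - 1) (m - 1)"
    using arg_cong[OF Suc[of "m - 1"], of "\<lambda>x. real m * x"]
    by (cases m) (simp_all add: right_diff_distrib mult.assoc del: of_nat_Suc)
  moreover have "real j * charlier l j m =
      real j * charlier l (j - 1) m - real j * (real m / l) * charlier l (j - 1) (m - 1)"
    by (cases j) (auto simp: algebra_simps)
  moreover have *: "real m * (real j / l) = real j * (real m / l)" by simp
  ultimately have "real m * charlier l j m + real j * charlier l (j - 1) m =
      real m * charlier l j (m - 1) + real j * charlier l j m"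
    unfolding * by linarith
  from arg_cong[OF this, of "\<lambda>x. x / l"]
  have "real m / l * charlier l j m + real j / l * charlier l (j - 1) m =
      real m / l * charlier l j (m - 1) + real j / l * charlier l j m"
    by (simp add: add_divide_distrib)
  then show ?case
    by (simp add: Suc[of m] algebra_simps add_divide_distrib)
qed simp

text \<open>Growth at most geometric in the degree, so that weights l^m / m! make all products
  summable.\<close>

lemma abs_charlier_le:
  assumes "l > 0"
  shows "\<bar>charlier l j m\<bar> \<le> (1 + real j / l) ^ m"
proof (induction m arbitrary: j)
  case (Suc m)
  have "\<bar>charlier l j (Suc m)\<bar> \<le> \<bar>charlier l j m\<bar> + real j / l * \<bar>charlier l (j - 1) m\<bar>"
    unfolding charlier_Suc_right using assms by (simp add: abs_mult order_trans[OF abs_triangle_ineq4])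
  also have "\<dots> \<le> (1 + real j / l) ^ m + real j / l * (1 + real j / l) ^ m"
    using assms Suc[of j]
    by (intro add_mono mult_left_mono order_trans[OF Suc[of "j - 1"]] power_mono)
      (auto simp: divide_right_mono)
  finally show ?case
    by (simp add: algebra_simps)
qed simp

lemma summable_charlier_mult:
  assumes "l > 0"
  shows "summable (\<lambda>m. l ^ m / fact m * (charlier l j m * charlier l k m))"
proof (rule summable_comparison_test)
  let ?x = "l * (1 + real j / l) * (1 + real k / l)"
  show "summable (\<lambda>m. ?x ^ m / fact m)"
    using summable_exp[of ?x] by (simp add: divide_inverse mult.commute)
  have "\<bar>charlier l j m\<bar> * \<bar>charlier l k m\<bar> \<le> (1 + real j / l) ^ m * (1 + real k / l) ^ m" for m
    using assms by (intro mult_mono abs_charlier_le) auto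
  then show "\<exists>N. \<forall>m\<ge>N. norm (l ^ m / fact m * (charlier l j m * charlier l k m)) \<le> ?x ^ m / fact m"
    using assms
    by (auto simp: abs_mult power_mult_distrib mult.assoc intro!: divide_right_mono mult_left_mono)
qed

text \<open>Summation by parts: the left-hand recursion turns into the difference operator on the
  other factor.\<close>

lemma suminf_charlier_mult_Suc:
  assumes "l > 0"
  shows "(\<Sum>m. l ^ m / fact m * (charlier l (Suc j) m * charlier l k m)) =
    real k / l * (\<Sum>m. l ^ m / fact m * (charlier l j m * charlier l (k - 1) m))"
proof -
  let ?t = "\<lambda>j k m. l ^ m / fact m * (charlier l j m * charlier l k m)"
  have s: "?t j k sums (suminf (?t j k))" for j k
    using summable_charlier_mult[OF assms] by (rule summable_sums)
  have "(\<lambda>m. ?t j k m - real k / l * ?t j (k - 1) m) sums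
      (suminf (?t j k) - real k / l * suminf (?t j (k - 1)))"
    by (intro sums_diff sums_mult s)
  also have "(\<lambda>m. ?t j k m - real k / l * ?t j (k - 1) m) =
      (\<lambda>m. l ^ Suc m / fact (Suc m) * (real (Suc m) / l * charlier l j (Suc m - 1) * charlier l k (Suc m)))"
    using assms by (auto simp: charlier_Suc_right field_simps simp del: of_nat_Suc)
  finally have "(\<lambda>m. l ^ m / fact m * (real m / l * charlier l j (m - 1) * charlier l k m)) sums
      (suminf (?t j k) - real k / l * suminf (?t j (k - 1)))"
    by (subst (asm) sums_Suc_iff) simp
  from sums_diff[OF s[of j k] this]
  have "(\<lambda>m. ?t (Suc j) k m) sums (real k / l * suminf (?t j (k - 1)))"
    by (simp add: algebra_simps)
  then show ?thesis by (simp add: sums_iff)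
qed

text \<open>The dual relation: the sum runs over the degree, with the points \<open>j\<close> and
  \<open>k\<close> fixed. On the diagonal it gives the reciprocal of the Poisson weight of k.
  Summation by parts lowers both points together.\<close>

lemma charlier_orthogonal:
  assumes "l > 0"
  shows "(\<lambda>m. l ^ m / fact m * (charlier l j m * charlier l k m)) sums
    (if j = k then exp l * fact k / l ^ k else 0)"
proof -
  have "(\<Sum>m. l ^ m / fact m * (charlier l j m * charlier l k m)) =
    (if j = k then exp l * fact k / l ^ k else 0)"
  proof (induction j arbitrary: k)
    case 0
    \<comment> \<open>With the factors exchanged, the recursion applies with second point 0, whose
      coefficient 0 / l annihilates the sum for k > 0.\<close>
    have "(\<Sum>m. l ^ m / fact m * (charlier l k m * charlier l 0 m)) =
        (if 0 = k then exp l * fact k / l ^ k else 0)"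
    proof (cases k)
      case 0
      then show ?thesis
        using exp_converges[of l] by (simp add: sums_iff divide_inverse mult.commute)
    next
      case (Suc i)
      then show ?thesis
        using suminf_charlier_mult_Suc[OF assms, of i 0] by simp
    qed
    then show ?case by (simp add: mult.commute)
  next
    case (Suc j)
    have "(\<Sum>m. l ^ m / fact m * (charlier l (Suc j) m * charlier l k m)) =
        real k / l * (if j = k - 1 then exp l * fact (k - 1) / l ^ (k - 1) else 0)"
      by (subst suminf_charlier_mult_Suc[OF assms], subst Suc) (rule refl)
    also have "\<dots> = (if Suc j = k then exp l * fact k / l ^ k else 0)"
      by (cases k) (auto simp: mult_ac)
    finally show ?case .
  qed
  with summable_charlier_mult[OF assms, of j k] show ?thesis
    by (simp add: sums_iff)
qed

text \<open>Each step in the point multiplies the sum by 1 + t. Averaged over W, the right-hand side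
  becomes the generating function of W at 1 + t divided by that of the Poisson law.\<close>

lemma charlier_gf:
  fixes t :: complex
  assumes "l > 0"
  shows "(\<lambda>m. (- of_real l * t) ^ m / fact m * of_real (charlier l j m)) sums
    (exp (- of_real l * t) * (1 + t) ^ j)"
proof (induction j)
  case 0
  then show ?case
    using exp_converges[of "- of_real l * t"] by (simp add: scaleR_conv_of_real field_simps)
next
  case (Suc j)
  let ?S = "exp (- of_real l * t) * (1 + t) ^ j"
  have "(\<lambda>m. - t * ((- of_real l * t) ^ m / fact m * of_real (charlier l j m))) sums (- t * ?S)"
    by (intro sums_mult Suc)
  also have "(\<lambda>m. - t * ((- of_real l * t) ^ m / fact m * of_real (charlier l j m))) =
      (\<lambda>m. (- of_real l * t) ^ Suc m / fact (Suc m) *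
         of_real (real (Suc m) / l * charlier l j (Suc m - 1)))"
    using assms by (auto simp: field_simps simp del: of_nat_Suc)
  finally have "(\<lambda>m. (- of_real l * t) ^ m / fact m * of_real (real m / l * charlier l j (m - 1)))
      sums (- t * ?S)"
    by (subst (asm) sums_Suc_iff) simp
  from sums_diff[OF Suc this] show ?case
    by (simp add: algebra_simps)
qed

section \<open>The Pearson distance\<close>

lemma power_series_coeff_le:
  fixes a :: "nat \<Rightarrow> complex"
  assumes sums: "\<And>z. (\<lambda>m. a m * z ^ m) sums f z" and hol: "f holomorphic_on UNIV"
    and R: "R > 0" and bound: "\<And>z. norm z = R \<Longrightarrow> norm (f z) \<le> B"
  shows "norm (a m) \<le> B / R ^ m"
proof -
  have "f has_fps_expansion Abs_fps a"
    by (rule has_fps_expansionI) (simp add: sums)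
  from fps_nth_fps_expansion[OF this, of m]
  have "norm (a m) = norm ((deriv ^^ m) f 0) / fact m" by (simp add: norm_divide)
  moreover have "norm ((deriv ^^ m) f 0) \<le> fact m * B / R ^ m"
    using R bound hol
    by (intro Cauchy_inequality)
      (auto intro: holomorphic_on_subset holomorphic_on_imp_continuous_on)
  ultimately have "norm (a m) \<le> fact m * B / R ^ m / fact m"
    by (metis divide_right_mono fact_ge_zero)
  then show ?thesis by simp
qed

text \<open>Squaring, 1 + 2 Re z + \<bar>z\<bar>^2 \<le> exp (2 Re z + \<bar>z\<bar>^2), and the
  factor exp (- 2 Re z) cancels the linear term.\<close>

lemma norm_one_plus_times_exp_minus_le:
  fixes z :: complex
  shows "norm ((1 + z) * exp (- z)) \<le> exp ((norm z)\<^sup>2 / 2)"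
proof (rule power2_le_imp_le)
  have "(norm ((1 + z) * exp (- z)))\<^sup>2 = (norm (1 + z))\<^sup>2 * exp (- 2 * Re z)"
    by (simp add: norm_mult power_mult_distrib exp_double[symmetric])
  also have "(norm (1 + z))\<^sup>2 = 1 + (2 * Re z + (norm z)\<^sup>2)"
    by (simp add: cmod_power2) (simp add: power2_eq_square algebra_simps)
  also have "\<dots> * exp (- 2 * Re z) \<le> exp (2 * Re z + (norm z)\<^sup>2) * exp (- 2 * Re z)"
    by (intro mult_right_mono exp_ge_add_one_self) auto
  also have "\<dots> = (exp ((norm z)\<^sup>2 / 2))\<^sup>2"
    by (simp add: exp_add[symmetric] exp_double[symmetric])
  finally show "(norm ((1 + z) * exp (- z)))\<^sup>2 \<le> (exp ((norm z)\<^sup>2 / 2))\<^sup>2" .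
qed simp

lemma poisson_pmf_sums_1:
  assumes "l > 0"
  shows "pmf (poisson_pmf l) sums 1"
proof -
  have "(\<lambda>k. l ^ k / fact k * exp (- l)) sums (exp l * exp (- l))"
    using exp_converges[of l] by (intro sums_mult2) (simp add: divide_inverse mult.commute)
  moreover have "pmf (poisson_pmf l) = (\<lambda>k. l ^ k / fact k * exp (- l))"
    using assms by auto
  ultimately show ?thesis by (simp add: exp_minus)
qed

section \<open>Charlier coefficients of the likelihood ratio\<close>

locale bernoulli_sum =
  fixes n :: nat and p :: "nat \<Rightarrow> real" and w v :: "nat \<Rightarrow> real" and l l2 :: real
  assumes p: "\<forall>j\<in>{1..n}. p j \<in> {0..1}" and l_pos: "l > 0"
    and l_def: "l = (\<Sum>j=1..n. p j)" and l2_def: "l2 = (\<Sum>j=1..n. (p j)\<^sup>2)"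
    and w_def: "w = pmf (bernoulli_sum_pmf n p)" and v_def: "v = pmf (poisson_pmf l)"
begin

lemma w_nonneg: "w k \<ge> 0" and v_pos: "v k > 0"
  using l_pos by (auto simp: w_def v_def)

lemma w_eq_0: "k > n \<Longrightarrow> w k = 0"
  using pmf_bernoulli_sum_eq_0[OF p] by (simp add: w_def)

lemma sums_w_times: "(\<lambda>k. w k * g k) sums (\<Sum>k\<le>n. w k * g k)"
  by (rule sums_finite) (auto simp: w_eq_0)

lemma w_sums_1: "w sums 1"
  using sums_w_times[of "\<lambda>_. 1"] bernoulli_sum_total[OF p] by (simp add: w_def)

lemma v_sums_1: "v sums 1"
  using poisson_pmf_sums_1[OF l_pos] by (simp add: v_def)

lemma l2_pos: "l2 > 0"
proof -
  have "\<exists>j\<in>{1..n}. p j \<noteq> 0"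
    using l_pos unfolding l_def by (metis less_irrefl sum.neutral)
  then obtain j where "j \<in> {1..n}" "(p j)\<^sup>2 > 0" by auto
  then show ?thesis unfolding l2_def by (intro sum_pos2[of _ j]) auto
qed

lemma l2_le: "l2 \<le> l"
  unfolding l_def l2_def using p by (intro sum_mono) (auto simp: power2_eq_square mult_left_le)

lemma chi2_eq: "chi2_distance (bernoulli_sum_pmf n p) (poisson_pmf l) = (\<Sum>k\<le>n. w k * (w k / v k)) - 1"
proof -
  have "(\<lambda>k. w k * (w k / v k) - 2 * w k + v k) sums ((\<Sum>k\<le>n. w k * (w k / v k)) - 2 * 1 + 1)"
    by (intro sums_add sums_diff sums_mult sums_w_times w_sums_1 v_sums_1)
  moreover have "w k * (w k / v k) - 2 * w k + v k = (w k - v k)\<^sup>2 / v k" for k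
    using v_pos[of k] by (simp add: field_simps power2_eq_square)
  ultimately have "(\<lambda>k. (w k - v k)\<^sup>2 / v k) sums ((\<Sum>k\<le>n. w k * (w k / v k)) - 1)"
    by simp
  then show ?thesis
    unfolding chi2_distance_def w_def[symmetric] v_def[symmetric] by (simp add: sums_iff)
qed

text \<open>Since w = (w / v) v, this is the Poisson inner product of the likelihood ratio with the
  Charlier polynomial of degree \<open>m\<close>.\<close>

definition charlier_mean :: "nat \<Rightarrow> real" where
  "charlier_mean m = (\<Sum>j\<le>n. w j * charlier l j m)"

text \<open>Expanding the square gives a finite double sum over points; dual orthogonality keeps the
  diagonal, that is, the sum of w_j^2 / v_j. Only finite sums are exchanged with the series, so no
  separate completeness argument arises.\<close>

lemma chi2_parseval:
  "(\<lambda>m. l ^ m / fact m * (charlier_mean m)\<^sup>2) sums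
    (chi2_distance (bernoulli_sum_pmf n p) (poisson_pmf l) + 1)"
proof -
  let ?C = "charlier l"
  have "(\<lambda>m. \<Sum>j\<le>n. \<Sum>k\<le>n. w j * w k * (l ^ m / fact m * (?C j m * ?C k m))) sums
      (\<Sum>j\<le>n. \<Sum>k\<le>n. w j * w k * (if j = k then exp l * fact k / l ^ k else 0))"
    by (intro sums_sum sums_mult charlier_orthogonal l_pos)
  also have "(\<lambda>m. \<Sum>j\<le>n. \<Sum>k\<le>n. w j * w k * (l ^ m / fact m * (?C j m * ?C k m))) =
      (\<lambda>m. l ^ m / fact m * (charlier_mean m)\<^sup>2)"
  proof
    fix m
    have "l ^ m / fact m * (charlier_mean m)\<^sup>2 =
        l ^ m / fact m * (\<Sum>j\<le>n. \<Sum>k\<le>n. w j * ?C j m * (w k * ?C k m))"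
      by (simp only: charlier_mean_def power2_eq_square sum_product)
    also have "\<dots> = (\<Sum>j\<le>n. \<Sum>k\<le>n. w j * w k * (l ^ m / fact m * (?C j m * ?C k m)))"
      unfolding sum_distrib_left by (intro sum.cong refl) (simp only: mult_ac)
    finally show "(\<Sum>j\<le>n. \<Sum>k\<le>n. w j * w k * (l ^ m / fact m * (?C j m * ?C k m))) =
        l ^ m / fact m * (charlier_mean m)\<^sup>2" ..
  qed
  also have "(\<Sum>j\<le>n. \<Sum>k\<le>n. w j * w k * (if j = k then exp l * fact k / l ^ k else 0)) =
      (\<Sum>j\<le>n. w j * (w j / v j))"
  proof (intro sum.cong refl)
    fix j assume j: "j \<in> {..n}"
    have "(\<Sum>k\<le>n. w j * w k * (if j = k then exp l * fact k / l ^ k else 0)) =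
        w j * w j * (exp l * fact j / l ^ j)"
      using j by (simp add: if_distrib[of "\<lambda>x. _ * x"] cong: if_cong)
    also have "exp l * fact j / l ^ j = 1 / v j"
      using l_pos by (simp add: v_def exp_minus field_simps)
    finally show "(\<Sum>k\<le>n. w j * w k * (if j = k then exp l * fact k / l ^ k else 0)) =
        w j * (w j / v j)" by simp
  qed
  finally show ?thesis by (simp add: chi2_eq)
qed

lemma charlier_mean_0: "charlier_mean 0 = 1"
  unfolding charlier_mean_def using bernoulli_sum_total[OF p] by (simp add: w_def)

lemma charlier_mean_1: "charlier_mean (Suc 0) = 0"
proof -
  have "charlier_mean (Suc 0) = (\<Sum>j\<le>n. w j) - (\<Sum>j\<le>n. w j * real j) / l"
    unfolding charlier_mean_def charlier_Suc_right
    by (simp add: right_diff_distrib sum_subtractf sum_divide_distrib)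
  then show ?thesis
    unfolding w_def bernoulli_sum_total[OF p] bernoulli_sum_mean[OF p] using l_pos by (simp add: l_def)
qed

lemma charlier_mean_2: "charlier_mean (Suc (Suc 0)) = - l2 / l\<^sup>2"
proof -
  have C: "charlier l j (Suc (Suc 0)) = 1 - (2 / l + 1 / l\<^sup>2) * real j + (real j)\<^sup>2 / l\<^sup>2" for j
    using l_pos by (cases j) (auto simp: charlier_Suc_right field_simps power2_eq_square)
  have "charlier_mean (Suc (Suc 0)) =
      (\<Sum>j\<le>n. w j) - (2 / l + 1 / l\<^sup>2) * (\<Sum>j\<le>n. w j * real j) + (\<Sum>j\<le>n. w j * (real j)\<^sup>2) / l\<^sup>2"
    unfolding charlier_mean_def C sum_distrib_left sum_divide_distrib
      sum_subtractf[symmetric] sum.distrib[symmetric]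
    by (intro sum.cong) (auto simp: algebra_simps)
  then show ?thesis
    unfolding w_def bernoulli_sum_total[OF p] bernoulli_sum_mean[OF p] bernoulli_sum_second_moment[OF p]
      l_def[symmetric] l2_def[symmetric]
    using l_pos by (simp add: field_simps power2_eq_square)
qed

lemma charlier_mean_gf:
  fixes z :: complex
  shows "(\<lambda>m. of_real ((- l) ^ m / fact m * charlier_mean m) * z ^ m) sums
    (\<Prod>j=1..n. (1 + of_real (p j) * z) * exp (- (of_real (p j) * z)))"
proof -
  have "(\<lambda>m. \<Sum>j\<le>n. of_real (w j) * ((- of_real l * z) ^ m / fact m * of_real (charlier l j m))) sums
      (\<Sum>j\<le>n. of_real (w j) * (exp (- of_real l * z) * (1 + z) ^ j))"
    by (rule sums_sum, rule sums_mult, rule charlier_gf, rule l_pos)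
  also have "(\<lambda>m. \<Sum>j\<le>n. of_real (w j) * ((- of_real l * z) ^ m / fact m * of_real (charlier l j m))) =
      (\<lambda>m. of_real ((- l) ^ m / fact m * charlier_mean m) * z ^ m)"
  proof
    fix m
    have pow: "(- of_real l * z) ^ m = of_real ((- l) ^ m) * z ^ m"
      by (simp only: power_mult_distrib of_real_power of_real_minus)
    have "of_real ((- l) ^ m / fact m * charlier_mean m) * z ^ m =
        (- of_real l * z) ^ m / fact m * of_real (charlier_mean m)"
      unfolding pow by simp
    also have "\<dots> = (\<Sum>j\<le>n. of_real (w j) * ((- of_real l * z) ^ m / fact m * of_real (charlier l j m)))"
      unfolding charlier_mean_def of_real_sum sum_distrib_left
      by (intro sum.cong refl) (simp add: mult_ac)
    finally show "(\<Sum>j\<le>n. of_real (w j) * ((- of_real l * z) ^ m / fact m * of_real (charlier l j m))) =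
        of_real ((- l) ^ m / fact m * charlier_mean m) * z ^ m" ..
  qed
  also have "(\<Sum>j\<le>n. of_real (w j) * (exp (- of_real l * z) * (1 + z) ^ j)) =
      (\<Sum>j\<le>n. pmf (bernoulli_sum_pmf n p) j *\<^sub>R (1 + z) ^ j) * exp (- of_real l * z)"
    unfolding sum_distrib_right
    by (intro sum.cong refl) (simp add: w_def scaleR_conv_of_real)
  also have "\<dots> = (\<Prod>j=1..n. 1 + of_real (p j) * z) * exp (\<Sum>j=1..n. - (of_real (p j) * z))"
    unfolding bernoulli_sum_gf[OF p]
    by (simp add: l_def algebra_simps sum_negf sum_distrib_left)
  also have "\<dots> = (\<Prod>j=1..n. (1 + of_real (p j) * z) * exp (- (of_real (p j) * z)))"
    by (simp only: exp_sum finite_atLeastAtMost prod.distrib)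
  finally show ?thesis .
qed

lemma charlier_mean_term_le:
  assumes "m \<ge> 1"
  shows "l ^ m / fact m * (charlier_mean m)\<^sup>2 \<le> exp 1 * sqrt (real m) * (l2 / l) ^ m"
proof -
  have m: "real m > 0" using assms by simp
  \<comment> \<open>The radius minimising exp (l2 R^2 / 2) / R^m, the bound from Cauchy's
    inequality.\<close>
  define R where "R = sqrt (real m / l2)"
  have R: "R > 0" "R\<^sup>2 = real m / l2" using m l2_pos by (auto simp: R_def)
  let ?f = "\<lambda>z. \<Prod>j=1..n. (1 + of_real (p j) * z) * exp (- (of_real (p j) * z)) :: complex"
  have "norm (of_real ((- l) ^ m / fact m * charlier_mean m) :: complex) \<le> exp (real m / 2) / R ^ m"
  proof (rule power_series_coeff_le[OF charlier_mean_gf _ R(1)])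
    show "?f holomorphic_on UNIV" by (intro holomorphic_intros)
    fix z :: complex assume z: "norm z = R"
    have "norm (?f z) \<le> (\<Prod>j=1..n. exp ((norm (of_real (p j) * z))\<^sup>2 / 2))"
      unfolding prod_norm[symmetric] by (intro prod_mono conjI norm_one_plus_times_exp_minus_le) auto
    also have "\<dots> = exp (\<Sum>j=1..n. (p j)\<^sup>2 * (R\<^sup>2 / 2))"
      by (subst exp_sum) (auto simp: norm_mult power_mult_distrib z)
    also have "(\<Sum>j=1..n. (p j)\<^sup>2 * (R\<^sup>2 / 2)) = l2 * (R\<^sup>2 / 2)"
      unfolding l2_def by (simp only: sum_distrib_right)
    also have "\<dots> = real m / 2" using l2_pos by (simp add: R)
    finally show "norm (?f z) \<le> exp (real m / 2)" .
  qed
  then have "l ^ m / fact m * \<bar>charlier_mean m\<bar> \<le> exp (real m / 2) / R ^ m"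
    using l_pos by (simp only: norm_of_real) (simp add: abs_mult power_abs)
  then have "(l ^ m / fact m * \<bar>charlier_mean m\<bar>)\<^sup>2 \<le> (exp (real m / 2) / R ^ m)\<^sup>2"
    using l_pos by (intro power_mono) auto
  also have "(exp (real m / 2) / R ^ m)\<^sup>2 = exp (real m) * (l2 / real m) ^ m"
  proof -
    have "(R ^ m)\<^sup>2 = (real m / l2) ^ m"
      by (simp only: R(2)[symmetric] power_mult[symmetric] mult.commute)
    then show ?thesis
      by (simp add: power_divide exp_double[symmetric])
  qed
  finally have *: "(l ^ m / fact m * \<bar>charlier_mean m\<bar>)\<^sup>2 \<le> exp (real m) * (l2 / real m) ^ m" .
  have "l ^ m / fact m * (charlier_mean m)\<^sup>2 =
      fact m / l ^ m * (l ^ m / fact m * \<bar>charlier_mean m\<bar>)\<^sup>2"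
    using l_pos by (simp add: power_mult_distrib power_divide) (simp add: power2_eq_square)
  also have "\<dots> \<le> (exp 1 * sqrt (real m) * real m ^ m * exp (- real m)) / l ^ m *
      (exp (real m) * (l2 / real m) ^ m)"
    using l_pos * fact_le_stirling[OF assms] by (intro mult_mono divide_right_mono) auto
  also have "\<dots> = exp 1 * sqrt (real m) * (l2 / l) ^ m"
    using m l_pos by (simp add: power_divide exp_minus field_simps)
  finally show ?thesis .
qed

text \<open>Degrees 0, 1 and 2 of the Parseval series contribute 1, 0 and half the square of l2 /
  l.\<close>

lemma chi2_ge: "(l2 / l)\<^sup>2 / 2 \<le> chi2_distance (bernoulli_sum_pmf n p) (poisson_pmf l)"
proof -
  let ?t = "\<lambda>m. l ^ m / fact m * (charlier_mean m)\<^sup>2"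
  have "(\<Sum>m<3. ?t m) \<le> suminf ?t"
    using chi2_parseval l_pos by (intro sum_le_suminf) (auto simp: sums_iff)
  also have "(\<Sum>m<3. ?t m) = 1 + (l2 / l)\<^sup>2 / 2"
    using l_pos by (simp add: eval_nat_numeral charlier_mean_0 charlier_mean_1 charlier_mean_2)
  finally show ?thesis using chi2_parseval by (simp add: sums_iff)
qed

lemma chi2_le:
  assumes "l2 / l \<le> 1 / 2"
  shows "chi2_distance (bernoulli_sum_pmf n p) (poisson_pmf l) \<le> 6 * exp 1 * (l2 / l)\<^sup>2"
proof -
  let ?t = "\<lambda>m. l ^ m / fact m * (charlier_mean m)\<^sup>2"
  define \<kappa> where "\<kappa> = l2 / l"
  have \<kappa>: "0 \<le> \<kappa>" "\<kappa> \<le> 1 / 2" using assms l_pos l2_pos by (auto simp: \<kappa>_def)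
  have "(\<lambda>m. ?t (m + 2)) sums (chi2_distance (bernoulli_sum_pmf n p) (poisson_pmf l) + 1 - (\<Sum>m<2. ?t m))"
    using chi2_parseval by (rule sums_split_initial_segment)
  then have s: "(\<lambda>m. ?t (m + 2)) sums chi2_distance (bernoulli_sum_pmf n p) (poisson_pmf l)"
    by (simp add: eval_nat_numeral charlier_mean_0 charlier_mean_1)
  \<comment> \<open>The majorant of the terms from degree 2 on, using \<kappa> \<le> 1/2 for all but
    two powers of \<kappa>; the 6 is 4 from the differentiated geometric series plus 2 from the
    plain one.\<close>
  have g: "(\<lambda>m. exp 1 * \<kappa>\<^sup>2 * (real (m + 2) * (1 / 2) ^ m)) sums (exp 1 * \<kappa>\<^sup>2 * 6)"
  proof (rule sums_mult)
    have "(\<lambda>m. real (Suc m) * (1 / 2) ^ m) sums (4 :: real)"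
      using geometric_deriv_sums[of "1 / 2 :: real"] by (simp add: power2_eq_square)
    moreover have "(\<lambda>m. (1 / 2) ^ m) sums (2 :: real)"
      using geometric_sums[of "1 / 2 :: real"] by simp
    ultimately have "(\<lambda>m. real (Suc m) * (1 / 2) ^ m + (1 / 2) ^ m) sums (4 + 2 :: real)"
      by (rule sums_add)
    then show "(\<lambda>m. real (m + 2) * (1 / 2) ^ m) sums 6"
      by (simp add: algebra_simps)
  qed
  have "chi2_distance (bernoulli_sum_pmf n p) (poisson_pmf l) \<le> exp 1 * \<kappa>\<^sup>2 * 6"
  proof (rule sums_le[OF _ s g])
    fix m
    have "?t (m + 2) \<le> exp 1 * sqrt (real (m + 2)) * \<kappa> ^ (m + 2)"
      unfolding \<kappa>_def by (rule charlier_mean_term_le) simp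
    also have "\<dots> \<le> exp 1 * real (m + 2) * (\<kappa>\<^sup>2 * (1 / 2) ^ m)"
    proof (intro mult_mono)
      show "sqrt (real (m + 2)) \<le> real (m + 2)"
        by (intro real_le_lsqrt) (auto simp: power2_eq_square)
      show "\<kappa> ^ (m + 2) \<le> \<kappa>\<^sup>2 * (1 / 2) ^ m"
        unfolding power_add mult.commute[of "\<kappa>\<^sup>2"]
        using \<kappa> by (intro mult_right_mono power_mono) auto
    qed (use \<kappa> in auto)
    finally show "?t (m + 2) \<le> exp 1 * \<kappa>\<^sup>2 * (real (m + 2) * (1 / 2) ^ m)"
      by (simp add: mult_ac)
  qed
  then show ?thesis by (simp add: \<kappa>_def)
qed

end

section \<open>The Tsallis entropy\<close>

context bernoulli_sum
begin

abbreviation (input) W where "W \<equiv> bernoulli_sum_pmf n p"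
abbreviation (input) Z where "Z \<equiv> poisson_pmf l"

lemma tsallis_summable: "summable (\<lambda>k. (w k / v k) powr a * v k)"
  using bernoulli_sum_poisson_summable(1)[where n = n and p = p and \<alpha> = a] l_pos
  unfolding w_def v_def l_def .

text \<open>The subtracted affine function of w / v has Poisson mean 1. Subtracting it makes each
  term of second order in w / v - 1, so comparison with the Pearson distance is termwise.\<close>

lemma tsallis_sums:
  "(\<lambda>k. v k * ((w k / v k) powr a - 1 - a * (w k / v k - 1))) sums
    ((\<Sum>k. (w k / v k) powr a * v k) - 1)"
proof -
  have "(\<lambda>k. (w k / v k) powr a * v k - v k - a * (w k - v k)) sums
      ((\<Sum>k. (w k / v k) powr a * v k) - 1 - a * (1 - 1))"
    by (intro sums_diff sums_mult summable_sums tsallis_summable w_sums_1 v_sums_1)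
  moreover have "(w k / v k) powr a * v k - v k - a * (w k - v k) =
      v k * ((w k / v k) powr a - 1 - a * (w k / v k - 1))" for k
    using v_pos[of k] by (simp add: right_diff_distrib)
  ultimately show ?thesis by simp
qed

lemma chi2_sums: "(\<lambda>k. v k * (w k / v k - 1)\<^sup>2) sums chi2_distance W Z"
proof -
  have "summable (\<lambda>k. (w k - v k)\<^sup>2 / v k)"
    using bernoulli_sum_poisson_summable(2)[where n = n and p = p] l_pos
    unfolding w_def v_def l_def .
  then have "(\<lambda>k. (w k - v k)\<^sup>2 / v k) sums chi2_distance W Z"
    unfolding chi2_distance_def w_def[symmetric] v_def[symmetric] by (rule summable_sums)
  moreover have "(w k - v k)\<^sup>2 / v k = v k * (w k / v k - 1)\<^sup>2" for k
    using v_pos[of k] by (simp add: field_simps power2_eq_square)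
  ultimately show ?thesis by simp
qed

lemma tsallis_le_chi2:
  assumes a: "a > 1" and M: "M \<ge> 1" "\<And>k. w k / v k \<le> M"
  shows "tsallis_entropy a W Z \<le> a\<^sup>2 * M powr a / (a - 1) * chi2_distance W Z"
proof -
  have "(\<Sum>k. (w k / v k) powr a * v k) - 1 \<le> a\<^sup>2 * M powr a * chi2_distance W Z"
  proof (rule sums_le[OF _ tsallis_sums sums_mult[OF chi2_sums]])
    fix k
    have "v k * ((w k / v k) powr a - 1 - a * (w k / v k - 1)) \<le>
        v k * (a\<^sup>2 * M powr a * (w k / v k - 1)\<^sup>2)"
      using a M v_pos[of k] w_nonneg[of k] by (intro mult_left_mono powr_second_order_le) auto
    then show "v k * ((w k / v k) powr a - 1 - a * (w k / v k - 1)) \<le>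
        a\<^sup>2 * M powr a * (v k * (w k / v k - 1)\<^sup>2)"
      by (simp only: mult_ac)
  qed
  with a show ?thesis
    unfolding tsallis_entropy_def w_def[symmetric] v_def[symmetric]
    by (simp add: divide_right_mono)
qed

lemma tsallis_ge_chi2:
  assumes a: "a > 1" and M: "M \<ge> 1" "\<And>k. w k / v k \<le> M"
  shows "a * min 1 (a - 1) / (4 * M) / (a - 1) * chi2_distance W Z \<le> tsallis_entropy a W Z"
proof -
  define c where "c = a * min 1 (a - 1) / (4 * M)"
  have "c * chi2_distance W Z \<le> (\<Sum>k. (w k / v k) powr a * v k) - 1"
  proof (rule sums_le[OF _ sums_mult[OF chi2_sums] tsallis_sums])
    fix k
    have "v k * (c * (w k / v k - 1)\<^sup>2) \<le> v k * ((w k / v k) powr a - 1 - a * (w k / v k - 1))"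
      unfolding c_def
      using a M v_pos[of k] w_nonneg[of k] by (intro mult_left_mono powr_second_order_ge) auto
    then show "c * (v k * (w k / v k - 1)\<^sup>2) \<le> v k * ((w k / v k) powr a - 1 - a * (w k / v k - 1))"
      by (simp only: mult_ac)
  qed
  with a have "c * chi2_distance W Z / (a - 1) \<le> tsallis_entropy a W Z"
    unfolding tsallis_entropy_def w_def[symmetric] v_def[symmetric]
    by (simp add: divide_right_mono)
  then show ?thesis by (simp add: c_def)
qed

text \<open>One factor w / v turns v into w, the remaining power is at most
  \<open>M powr (a - 1)\<close>, and the - 1 is dropped.\<close>

lemma tsallis_le_powr:
  assumes a: "a > 1" and M: "\<And>k. w k / v k \<le> M"
  shows "tsallis_entropy a W Z \<le> M powr (a - 1) / (a - 1)"
proof -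
  have "(\<lambda>k. (w k / v k) powr a * v k) sums (\<Sum>k. (w k / v k) powr a * v k)"
    by (intro summable_sums tsallis_summable)
  then have "(\<Sum>k. (w k / v k) powr a * v k) \<le> M powr (a - 1) * 1"
  proof (rule sums_le[rotated, OF _ sums_mult[OF w_sums_1]])
    fix k
    have "(w k / v k) powr a * v k = (w k / v k) powr (a - 1) * w k"
    proof (cases "w k = 0")
      case False
      with w_nonneg[of k] have "w k > 0" by simp
      with v_pos[of k] have "(w k / v k) powr a = (w k / v k) powr (a - 1) * (w k / v k)"
        by (simp add: powr_diff)
      with v_pos[of k] show ?thesis by simp
    qed simp
    also have "\<dots> \<le> M powr (a - 1) * w k"
      using M[of k] a v_pos[of k] w_nonneg[of k] by (intro mult_right_mono powr_mono2) auto
    finally show "(w k / v k) powr a * v k \<le> M powr (a - 1) * w k" .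
  qed
  with a show ?thesis
    unfolding tsallis_entropy_def w_def[symmetric] v_def[symmetric]
    by (simp add: divide_right_mono)
qed

section \<open>Bounds governed by the size of F\<close>

definition F where "F = max 1 l / max 1 (l - l2)"

lemma F_ge_1: "F \<ge> 1"
  using l2_pos by (auto simp: F_def field_simps)

lemma ratio_le: "w k / v k \<le> 8 * exp 1 * sqrt F"
  unfolding w_def v_def F_def by (rule bernoulli_sum_ratio_le[OF p l_def l_pos l2_def])

text \<open>Chebyshev's inequality. \<open>s\<close> need only dominate the standard deviation, so
  it can be kept at least 1 when the variance is small.\<close>

lemma prob_within_two_deviations:
  assumes "A = {k\<in>{..n}. \<bar>real k - l\<bar> \<le> 2 * s}" "s > 0" "l - l2 \<le> s\<^sup>2"
  shows "sum w A \<ge> 3 / 4"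
proof -
  have "4 * s\<^sup>2 * sum w ({..n} - A) = (\<Sum>k\<in>{..n} - A. w k * (2 * s)\<^sup>2)"
    by (simp add: sum_distrib_left power_mult_distrib mult_ac)
  also have "\<dots> \<le> (\<Sum>k\<in>{..n} - A. w k * (real k - l)\<^sup>2)"
  proof (intro sum_mono mult_left_mono w_nonneg)
    fix k assume "k \<in> {..n} - A"
    then have "\<bar>2 * s\<bar> \<le> \<bar>real k - l\<bar>" using assms by auto
    then show "(2 * s)\<^sup>2 \<le> (real k - l)\<^sup>2" by (simp only: abs_le_square_iff)
  qed
  also have "\<dots> \<le> (\<Sum>k\<le>n. w k * (real k - l)\<^sup>2)"
    by (intro sum_mono2) (auto simp: w_nonneg)
  also have "\<dots> \<le> s\<^sup>2"
    using bernoulli_sum_variance[OF p] assms(3) by (simp add: w_def l_def l2_def)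
  finally have "sum w ({..n} - A) \<le> 1 / 4"
    using assms(2) by (simp add: field_simps)
  moreover have "sum w {..n} = sum w ({..n} - A) + sum w A"
    using assms(1) by (intro sum.subset_diff) auto
  moreover have "sum w {..n} = 1"
    using bernoulli_sum_total[OF p] by (simp add: w_def)
  ultimately show ?thesis by linarith
qed

text \<open>An interval of at most 5s integers carries W-mass 3/4 but Poisson mass of order 1 / sqrt
  F. The tangent inequality at a level \<open>y\<close> of order sqrt F, summed over that interval,
  turns this imbalance into a lower bound.\<close>

lemma tsallis_ge_powr:
  assumes a: "a > 1" and F16: "F \<ge> 16"
  shows "(20 * exp 1) powr (1 - a) / 2 * F powr ((a - 1) / 2) \<le> (a - 1) * tsallis_entropy a W Z + 1"
proof -
  define s where "s = sqrt (max 1 (l - l2))"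
  have s: "s \<ge> 1" "s\<^sup>2 = max 1 (l - l2)" by (auto simp: s_def)
  have "1 \<le> max 1 (l - l2)" by simp
  then have "max 1 l / max 1 (l - l2) \<le> max 1 l / 1" by (intro divide_left_mono) auto
  with F16 have l16: "l \<ge> 16" by (simp add: F_def)
  have Fs: "F = l / s\<^sup>2" using l16 by (simp add: F_def s)
  have sF: "sqrt F = sqrt l / s" unfolding Fs real_sqrt_divide real_sqrt_abs using s(1) by simp
  have "sqrt (4\<^sup>2) \<le> sqrt F" using F16 by (intro real_sqrt_le_mono) simp
  then have "4 \<le> sqrt l / s" by (simp add: sF)
  then have s4: "4 * s \<le> sqrt l" using s by (simp add: field_simps)
  have sl: "sqrt l \<le> l"
    using l16 by (intro real_le_lsqrt) (auto simp: power2_eq_square)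
  define A where "A = {k\<in>{..n}. \<bar>real k - l\<bar> \<le> 2 * s}"
  have wA: "sum w A \<ge> 3 / 4"
    using s by (intro prob_within_two_deviations[OF A_def]) auto
  have vk: "v k \<le> 2 * exp 1 / sqrt l" if "k \<in> A" for k
  proof -
    \<comment> \<open>F \<ge> 16 gives 4s \<le> sqrt l \<le> l, which keeps \<open>A\<close> away
      from 0 and makes the Poisson weights on it of order 1 / sqrt l.\<close>
    have k: "real k \<ge> l / 4" "real k \<ge> 1" using that s4 sl l16 by (auto simp: A_def)
    then have "sqrt (l / 2\<^sup>2) \<le> sqrt (real k)" by (intro real_sqrt_le_mono) simp
    then have "sqrt l / 2 \<le> sqrt (real k)" by (simp only: real_sqrt_divide real_sqrt_abs abs_numeral)
    then have "exp 1 / sqrt (real k) \<le> exp 1 / (sqrt l / 2)"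
      using l16 k by (intro divide_left_mono mult_pos_pos) auto
    moreover have "v k \<le> exp 1 / sqrt (real k)"
      unfolding v_def using k l_pos by (intro poisson_pmf_le) auto
    ultimately show ?thesis by (simp add: mult.commute[of 2])
  qed
  have "sum v A \<le> real (card A) * (2 * exp 1 / sqrt l)"
    using vk by (intro sum_bounded_above) auto
  also have "\<dots> \<le> (5 * s) * (2 * exp 1 / sqrt l)"
  proof (intro mult_right_mono)
    have "real (card A) \<le> 2 * (2 * s) + 1"
      by (rule card_nat_ball_le[where c = l]) (use s in \<open>auto simp: A_def\<close>)
    then show "real (card A) \<le> 5 * s" using s by linarith
  qed (use l_pos in auto)
  also have "\<dots> = 10 * exp 1 / sqrt F" using s by (simp add: sF)
  finally have vA: "sum v A \<le> 10 * exp 1 / sqrt F" .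
  \<comment> \<open>Chosen so that y times the Poisson mass of \<open>A\<close> is at most 1/2; then
    a * 3/4 - (a - 1) * 1/2 still exceeds 1/2.\<close>
  define y where "y = sqrt F / (20 * exp 1)"
  have y: "y > 0" using F_ge_1 by (simp add: y_def)
  have yv: "y * sum v A \<le> 1 / 2"
  proof -
    have "y * sum v A \<le> y * (10 * exp 1 / sqrt F)" using y vA by (intro mult_left_mono) auto
    also have "\<dots> = 1 / 2" using F_ge_1 by (simp add: y_def)
    finally show ?thesis .
  qed
  have "y powr (a - 1) * (1 / 2) \<le> y powr (a - 1) * (a * sum w A - (a - 1) * (y * sum v A))"
  proof (intro mult_left_mono)
    have "(a - 1) * (y * sum v A) \<le> (a - 1) * (1 / 2)" using a yv by (intro mult_left_mono) auto
    moreover have "a * (3 / 4) \<le> a * sum w A" using a wA by (intro mult_left_mono) auto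
    moreover have "1 / 2 \<le> x - z" if "z \<le> (a - 1) * (1 / 2)" "a * (3 / 4) \<le> x" for x z
      using that a by (simp add: field_simps)
    ultimately show "1 / 2 \<le> a * sum w A - (a - 1) * (y * sum v A)" by blast
  qed simp
  also have "\<dots> = (\<Sum>k\<in>A. y powr (a - 1) * (a * w k - (a - 1) * (y * v k)))"
    by (simp only: sum_subtractf sum_distrib_left right_diff_distrib)
  also have "\<dots> \<le> (\<Sum>k\<in>A. (w k / v k) powr a * v k)"
  proof (intro sum_mono)
    fix k
    have "(y powr a + a * y powr (a - 1) * (w k / v k - y)) * v k \<le> (w k / v k) powr a * v k"
      using a y v_pos[of k] w_nonneg[of k] by (intro mult_right_mono powr_ge_tangent) auto
    moreover have "y powr a = y powr (a - 1) * y" using y by (simp add: powr_diff)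
    ultimately show "y powr (a - 1) * (a * w k - (a - 1) * (y * v k)) \<le> (w k / v k) powr a * v k"
      using v_pos[of k] by (simp add: algebra_simps)
  qed
  also have "\<dots> \<le> (\<Sum>k. (w k / v k) powr a * v k)"
    using v_pos by (intro sum_le_suminf tsallis_summable) (auto simp: A_def less_imp_le)
  also have "\<dots> = (a - 1) * tsallis_entropy a W Z + 1"
    unfolding tsallis_entropy_def w_def[symmetric] v_def[symmetric] using a by simp
  also have "y powr (a - 1) * (1 / 2) = (20 * exp 1) powr (1 - a) / 2 * F powr ((a - 1) / 2)"
  proof -
    have "sqrt F = F powr (1 / 2)" using F_ge_1 by (simp add: powr_half_sqrt)
    then have "(sqrt F) powr (a - 1) = F powr ((a - 1) / 2)" by (simp add: powr_powr)
    moreover have "(20 * exp 1 :: real) powr (1 - a) = 1 / (20 * exp 1) powr (a - 1)"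
      using powr_minus_divide[of "20 * exp 1 :: real" "a - 1"] by simp
    ultimately show ?thesis using F_ge_1 by (simp add: y_def powr_divide)
  qed
  finally show ?thesis .
qed

text \<open>If l2 is at most half of l, the variance is at least l / 2 and hence F \<le> 2.\<close>

lemma ratio_le_of_small:
  assumes "l2 / l \<le> 1 / 2"
  shows "w k / v k \<le> 8 * exp 1 * sqrt 2"
proof -
  have "l2 \<le> l / 2" using assms l_pos by (simp add: field_simps)
  then have "max 1 l \<le> 2 * max 1 (l - l2)" by (auto simp: max_def)
  then have "F \<le> 2" by (simp add: F_def field_simps)
  then have "8 * exp 1 * sqrt F \<le> 8 * exp 1 * sqrt 2" by simp
  with ratio_le[of k] show ?thesis by linarith
qed

end

section \<open>Choice of the constants and assembly of the cases\<close>

theorem theorem1p2: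
  fixes \<alpha> :: real
  assumes "\<alpha> > 1"
  shows "(\<exists>c1 c2 :: real. c1 > 0 \<and> c2 > 0 \<and>
            (\<forall>(n :: nat) (p :: nat \<Rightarrow> real).
               n \<ge> 1 \<and> (\<forall>j\<in>{1..n}. p j \<in> {0..1}) \<and> (\<Sum>j=1..n. p j) > 0 \<longrightarrow>
               (let lam = (\<Sum>j=1..n. p j);
                    lam2 = (\<Sum>j=1..n. (p j)\<^sup>2);
                    F = max 1 lam / max 1 (lam - lam2);
                    T = tsallis_entropy \<alpha> (bernoulli_sum_pmf n p) (poisson_pmf lam)
                in c1 * (lam2 / lam)\<^sup>2 * F powr ((\<alpha> - 1) / 2) \<le> T \<and>
                   T \<le> c2 * (lam2 / lam)\<^sup>2 * F powr ((\<alpha> - 1) / 2))))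
       \<and> (\<exists>c :: real. c > 0 \<and>
            (\<forall>(n :: nat) (p :: nat \<Rightarrow> real).
               n \<ge> 1 \<and> (\<forall>j\<in>{1..n}. p j \<in> {0..1}) \<and> (\<Sum>j=1..n. p j) > 0 \<longrightarrow>
               (let lam = (\<Sum>j=1..n. p j);
                    lam2 = (\<Sum>j=1..n. (p j)\<^sup>2);
                    W = bernoulli_sum_pmf n p;
                    Z = poisson_pmf lam
                in lam2 / lam \<le> 1 / 2 \<longrightarrow>
                   tsallis_entropy \<alpha> W Z \<le> c * chi2_distance W Z)))"
proof -
  note a = assms
  define g :: "real \<Rightarrow> real" where "g F = F powr ((\<alpha> - 1) / 2)" for F
  define M :: real where "M = 8 * exp 1"
  \<comment> \<open>Half the constant of \<open>tsallis_ge_powr\<close>, so that one of two copies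
    of \<open>b * g F\<close> can absorb the + 1 there.\<close>
  define b where "b = (20 * exp 1) powr (1 - \<alpha>) / 4"
  \<comment> \<open>The threshold for large F: beyond it \<open>b * g F\<close> is at least 1, and
    16 is what \<open>tsallis_ge_powr\<close> asks for.\<close>
  define K where "K = max 16 ((1 / b) powr (2 / (\<alpha> - 1)))"
  define c where "c = \<alpha>\<^sup>2 * (M * sqrt 2) powr \<alpha> / (\<alpha> - 1)"
  \<comment> \<open>The constant of \<open>tsallis_ge_chi2\<close> for the ratio bound
    \<open>M * sqrt K\<close>, valid while F \<le> K.\<close>
  define d where "d = \<alpha> * min 1 (\<alpha> - 1) / (4 * (M * sqrt K)) / (\<alpha> - 1)"
  \<comment> \<open>First entry for F \<le> K, where \<open>g F\<close> is at most
    \<open>g K\<close> and \<open>chi2_ge\<close> supplies the 2; second entry for F > K.\<close>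
  define c1 where "c1 = min (d / (2 * g K)) (b / (\<alpha> - 1))"
  \<comment> \<open>First entry for l2 / l \<le> 1/2, through \<open>chi2_le\<close>; otherwise the
    square of l2 / l is at least 1/4, whence the 4.\<close>
  define c2 where "c2 = max (c * (6 * exp 1)) (4 * M powr (\<alpha> - 1) / (\<alpha> - 1))"
  have "exp (1::real) \<ge> 1" by simp
  then have M: "M \<ge> 1" unfolding M_def by linarith
  have b: "b > 0" by (simp add: b_def)
  have K: "K \<ge> 16" "K \<ge> (1 / b) powr (2 / (\<alpha> - 1))" by (auto simp: K_def)
  have c: "c > 0" using a M by (simp add: c_def)
  have MK: "M * sqrt K \<ge> 1" "M * sqrt 2 \<ge> 1"
    using M K mult_mono[of 1 M 1 "sqrt K"] mult_mono[of 1 M 1 "sqrt 2"] by auto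
  have gK: "g K > 0" using K by (simp add: g_def)
  have d: "d > 0" using a MK by (simp add: d_def)
  have c1: "c1 > 0" using a b d gK by (simp add: c1_def)
  have c2: "c2 > 0" using c by (simp add: c2_def less_max_iff_disj)
  have main: "c1 * (l2 / l)\<^sup>2 * g (max 1 l / max 1 (l - l2)) \<le>
        tsallis_entropy \<alpha> (bernoulli_sum_pmf n p) (poisson_pmf l) \<and>
      tsallis_entropy \<alpha> (bernoulli_sum_pmf n p) (poisson_pmf l) \<le>
        c2 * (l2 / l)\<^sup>2 * g (max 1 l / max 1 (l - l2)) \<and>
      (l2 / l \<le> 1 / 2 \<longrightarrow> tsallis_entropy \<alpha> (bernoulli_sum_pmf n p) (poisson_pmf l) \<le>
        c * chi2_distance (bernoulli_sum_pmf n p) (poisson_pmf l))"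
    if p: "\<forall>j\<in>{1..n}. p j \<in> {0..1}" and l: "l = (\<Sum>j=1..n. p j)" "l > 0"
      and l2: "l2 = (\<Sum>j=1..n. (p j)\<^sup>2)" for n p l l2
  proof -
    interpret bernoulli_sum n p "pmf (bernoulli_sum_pmf n p)" "pmf (poisson_pmf l)" l l2
      using p l l2 by unfold_locales auto
    let ?T = "tsallis_entropy \<alpha> (bernoulli_sum_pmf n p) (poisson_pmf l)"
    let ?X = "chi2_distance (bernoulli_sum_pmf n p) (poisson_pmf l)"
    define \<kappa> where "\<kappa> = (l2 / l)\<^sup>2"
    have \<kappa>: "0 \<le> \<kappa>" "\<kappa> \<le> 1"
      using l2_le l2_pos l_pos by (auto simp: \<kappa>_def power_le_one)
    have gF: "1 \<le> g F"
      unfolding g_def using F_ge_1 a by (intro ge_one_powr_ge_zero) auto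
    have small: "?T \<le> c * ?X" if "l2 / l \<le> 1 / 2"
      unfolding c_def
      using ratio_le_of_small[OF that] MK a by (intro tsallis_le_chi2) (auto simp: M_def)
    have lower: "c1 * \<kappa> * g F \<le> ?T"
    proof (cases "F \<le> K")
      case True
      have "g F \<le> g K" unfolding g_def using True F_ge_1 a by (intro powr_mono2) auto
      have "c1 * \<kappa> * g F \<le> d / (2 * g K) * \<kappa> * g K"
        using \<open>g F \<le> g K\<close> \<kappa> gF d gK by (intro mult_mono) (auto simp: c1_def)
      also have "\<dots> = d * (\<kappa> / 2)" using gK by simp
      also have "\<dots> \<le> d * ?X"
        using chi2_ge d by (intro mult_left_mono) (auto simp: \<kappa>_def)
      also have "\<dots> \<le> ?T"
        unfolding d_def
      proof (rule tsallis_ge_chi2[OF a MK(1)])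
        fix k
        have "M * sqrt F \<le> M * sqrt K" using True M by (intro mult_left_mono) auto
        with ratio_le[of k]
        show "pmf (bernoulli_sum_pmf n p) k / pmf (poisson_pmf l) k \<le> M * sqrt K"
          unfolding M_def by linarith
      qed
      finally show ?thesis .
    next
      case False
      have "1 / b = ((1 / b) powr (2 / (\<alpha> - 1))) powr ((\<alpha> - 1) / 2)"
      proof -
        have "2 / (\<alpha> - 1) * ((\<alpha> - 1) / 2) = 1" using a by simp
        then show ?thesis using b by (simp only: powr_powr) simp
      qed
      also have "\<dots> \<le> g F"
        unfolding g_def using False K a by (intro powr_mono2) auto
      finally have "1 \<le> b * g F" using b by (simp add: field_simps)
      moreover have "2 * b * g F \<le> (\<alpha> - 1) * ?T + 1"
        using tsallis_ge_powr[OF a] False K by (simp add: b_def g_def)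
      ultimately have "b * g F \<le> (\<alpha> - 1) * ?T" by linarith
      then have "b / (\<alpha> - 1) * g F \<le> ?T" using a by (simp add: field_simps)
      moreover have "c1 * \<kappa> * g F \<le> b / (\<alpha> - 1) * 1 * g F"
        using \<kappa> gF a b by (intro mult_mono) (auto simp: c1_def)
      ultimately show ?thesis by simp
    qed
    have upper: "?T \<le> c2 * \<kappa> * g F"
    proof (cases "l2 / l \<le> 1 / 2")
      case True
      have "?T \<le> c * ?X" by (rule small[OF True])
      also have "\<dots> \<le> c * (6 * exp 1 * \<kappa>)"
        unfolding \<kappa>_def using chi2_le[OF True] c by (intro mult_left_mono) auto
      also have "\<dots> = c * (6 * exp 1) * \<kappa> * 1" by simp
      also have "\<dots> \<le> c2 * \<kappa> * g F"
        using \<kappa> gF c2 by (intro mult_mono) (auto simp: c2_def)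
      finally show ?thesis .
    next
      case False
      then have "(1 / 2)\<^sup>2 \<le> \<kappa>" unfolding \<kappa>_def by (intro power_mono) auto
      then have k4: "1 \<le> 4 * \<kappa>" by (simp add: power2_eq_square)
      have "?T \<le> (M * sqrt F) powr (\<alpha> - 1) / (\<alpha> - 1)"
        using ratio_le by (intro tsallis_le_powr[OF a]) (simp add: M_def)
      also have "(M * sqrt F) powr (\<alpha> - 1) = M powr (\<alpha> - 1) * g F"
        using M F_ge_1 by (simp add: powr_mult g_def powr_half_sqrt[symmetric] powr_powr)
      also have "M powr (\<alpha> - 1) * g F / (\<alpha> - 1) = M powr (\<alpha> - 1) / (\<alpha> - 1) * 1 * g F" by simp
      also have "\<dots> \<le> M powr (\<alpha> - 1) / (\<alpha> - 1) * (4 * \<kappa>) * g F"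
        using k4 a gF by (intro mult_right_mono mult_left_mono) auto
      also have "\<dots> = 4 * M powr (\<alpha> - 1) / (\<alpha> - 1) * \<kappa> * g F" by simp
      also have "\<dots> \<le> c2 * \<kappa> * g F"
        using \<kappa> gF by (intro mult_right_mono) (auto simp: c2_def)
      finally show ?thesis .
    qed
    show ?thesis
      using lower upper small unfolding \<kappa>_def F_def by blast
  qed
  show ?thesis
    unfolding Let_def g_def[symmetric]
  proof (rule conjI, rule exI[of _ c1], rule exI[of _ c2], intro conjI c1 c2 allI impI,
      goal_cases lower upper chi2)
    case (lower n p)
    then show ?case using main[of n p, OF _ refl _ refl] by blast
  next
    case (upper n p)
    then show ?case using main[of n p, OF _ refl _ refl] by blast
  next
    case chi2
    show ?case
    proof (rule exI[of _ c], intro conjI c allI impI, goal_cases)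
      case (1 n p)
      then show ?case using main[of n p, OF _ refl _ refl] by blast
    qed
  qed
qed

end
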